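(* Let $q$ be a prime power, $n\geq 1$, $\boldsymbol{\alpha} = (\alpha_0 , \ldots , \alpha_n ) \in \mathbb{F}_q^{n+1}$, with characteristic degrees $c_1 , c_2$ and characteristic polynomials $A_1 , A_2$. For $\alpha_{n+1}\in\mathbb{F}_q$ let $\boldsymbol{\alpha}' := (\alpha_0 , \ldots , \alpha_n , \alpha_{n+1} ) \in \mathbb{F}_q^{n+2}$ be the corresponding extension, with characteristic degrees $c_1' , c_2'$ and characteristic polynomials $A_1' , A_2'$. (Since characteristic polynomials are in general not unique, "$A_1'=\ldots$, $A_2'=\ldots$" means that the given polynomials are characteristic polynomials of $\boldsymbol{\alpha}'$.) **Claim 1.** Suppose $\boldsymbol{\alpha} \in \mathcal{L}_n (r,r,0)$ where $0 \leq r \leq n_1 -1$; so $c_1 =r$, $c_2 = n+2-r$, $\deg A_1=r$ and $\deg A_2<r$. - There is exactly one value of $\alpha_{n+1}$ such that $\boldsymbol{\alpha}' \in \mathcal{L}_{n+1} (r,r,0)$. In this case $c_1' = c_1 = r$, $c_2' = c_2 +1 = n+3-r$, $A_1' = A_1$ and $A_2'= A_2$. - There are $q-1$ values of $\alpha_{n+1}$ such that $\boldsymbol{\alpha}' \in \mathcal{L}_{n+1} (r+1,r,1)$. In this case $c_1' = c_1 +1 = r+1$, $c_2' = c_2 = n+2-r$, $A_1' = A_1$ and $A_2' = \beta A_2 + T^{c_2 - c_1} A_1$ for some $\beta \in \mathbb{F}_q^*$, and there is a one-to-one correspondence between these values $\alpha_{n+1}$ and $\beta\in\mathbb{F}_q^*$.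 **Claim 2.** Suppose $\boldsymbol{\alpha} \in \mathcal{L}_n (r, \rho_1, \pi_1 )$ where $\pi_1 \geq 1$ and $0 \leq r \leq n_1 -1$ (and $r=\rho_1+\pi_1$); so $c_1 = r$, $c_2 = n+2-r$, $\deg A_1=\rho_1$, $\deg A_2=c_2$. For every $\alpha_{n+1}\in\mathbb{F}_q$ we have $\boldsymbol{\alpha}' \in \mathcal{L}_{n+1} (r+1, \rho_1, \pi_1 +1 )$, $c_1' = c_1 +1 = r+1$, $c_2' = c_2 = n+2-r$, $A_1' = A_1$ and $A_2' = \beta T^{c_2 - c_1} A_1 + A_2$ for some $\beta \in \mathbb{F}_q$, and there is a one-to-one correspondence between $\alpha_{n+1}\in\mathbb{F}_q$ and $\beta\in\mathbb{F}_q$. **Claim 3.** (a) Suppose $n$ is even and $\boldsymbol{\alpha} \in \mathcal{L}_n (n_1, n_1, 0 )$; so $c_1 = c_2 = n_1$, $\deg A_1=n_1$, $\deg A_2<n_1$. For every $\alpha_{n+1}\in\mathbb{F}_q$ we have $\boldsymbol{\alpha}' \in \mathcal{L}_{n+1} (n_1, n_1, 0 )$, $c_1' = c_1 = n_1$, $c_2' = c_2 +1 = n_1 +1$, $A_1' = \beta A_2 + A_1$ for some $\beta\in\mathbb{F}_q$ and $A_2' = A_2$, and there is a one-to-one correspondence between $\alpha_{n+1}\in\mathbb{F}_q$ and $\beta\in\mathbb{F}_q$. (b) Suppose $n$ is odd and $\boldsymbol{\alpha} \in \mathcal{L}_n (n_1, n_1, 0 )$; so $c_1 = n_1$, $c_2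 = n_1 +1$, $\deg A_1=n_1$, $\deg A_2<n_1$. - There is exactly one value of $\alpha_{n+1}$ such that $\boldsymbol{\alpha}' \in \mathcal{L}_{n+1} (n_1, n_1, 0 )$; in this case $c_1' = c_1 = n_1$, $c_2' = c_2 +1 = n_1 +2$, $A_1' = A_1$, $A_2' = A_2$. - There are $q-1$ values of $\alpha_{n+1}$ such that $\boldsymbol{\alpha}' \in \mathcal{L}_{n+1} (n_1 +1, n_1 +1, 0 )$; in this case $c_1' = c_1 +1 = n_1 +1$, $c_2' = c_2 = n_1 +1$, $A_1' = \beta A_2 + T A_1$ for some $\beta\in\mathbb{F}_q^*$ and $A_2' = A_1$, and there is a one-to-one correspondence between these values $\alpha_{n+1}$ and $\beta\in\mathbb{F}_q^*$. (c) Suppose $n$ is odd and $\boldsymbol{\alpha} \in \mathcal{L}_n (n_1, \rho_1, \pi_1 )$ where $\pi_1 \geq 1$ and $0 \leq \rho_1 \leq n_1 -1$; so $c_1 = n_1$, $c_2 = n_1 +1$, $\deg A_1=\rho_1$, $\deg A_2=n_1+1$. For every $\alpha_{n+1}\in\mathbb{F}_q$ we have $\boldsymbol{\alpha}' \in \mathcal{L}_{n+1} (n_1 +1, n_1 +1, 0 )$, $c_1' = c_2' = n_1 +1$, $A_1' = \beta T A_1 + A_2$ for some $\beta\in\mathbb{F}_q$ and $A_2' = A_1$, and there is a one-to-one correspondence between $\alpha_{n+1}\in\mathbb{F}_q$ and $\beta\in\mathbb{F}_q$.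
   Context: For an integer $n\ge 0$ put $n_1 := \lfloor \frac{n+2}{2} \rfloor$ and $n_2 := \lfloor \frac{n+3}{2} \rfloor$ (here $n_1,n_2$ always refer to $n$, not $n+1$, except inside the definition of $\mathcal{L}_{n+1}$, where $n$ is replaced by $n+1$). For $\boldsymbol{\alpha}=(\alpha_0,\ldots,\alpha_n) \in \mathbb{F}_q^{n+1}$ and $l,m \geq 1$ with $l+m-2 \leq n$, $H_{l,m}(\boldsymbol{\alpha})$ denotes the $l\times m$ Hankel matrix $(\alpha_{i+j-2})_{1\leq i\leq l,\,1\leq j\leq m}$. $\rho(\boldsymbol{\alpha})$ is the largest $l \in \{1,\ldots,n_1\}$ with $\det H_{l,l}(\boldsymbol{\alpha}) \neq 0$, or $0$ if there is no such $l$; and $\pi(\boldsymbol{\alpha}) := \operatorname{rank} H_{n_1,n_2}(\boldsymbol{\alpha}) - \rho(\boldsymbol{\alpha})$. $\mathcal{L}_n(r,\rho_1,\pi_1)$ is the set of $\boldsymbol{\alpha}\in\mathbb{F}_q^{n+1}$ with $\operatorname{rank} H_{n_1,n_2}(\boldsymbol{\alpha})=r$, $\rho(\boldsymbol{\alpha})=\rho_1$, $\pi(\boldsymbol{\alpha})=\pi_1$. Vectors $(v_0,\ldots,v_{m-1})^T\in\mathbb{F}_q^m$ are identified with polynomials $v_0+v_1T+\cdots+v_{m-1}T^{m-1}\in\mathbb{F}_q[T]$; $\deg 0=-\infty$. For $\boldsymbol{\alpha}\in\mathcal{L}_n(r,\rho_1,\pi_1)$ with $n\geq 1$, the characteristic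 degrees are $c_1:=r$ and $c_2:=n+2-r$. Characteristic polynomials of $\boldsymbol{\alpha}$ are coprime $A_1,A_2\in\mathbb{F}_q[T]$ with $\deg A_1=\rho_1$, $\deg A_2\leq c_2$, such that for all $l,m\ge1$ with $l+m-2=n$: $\ker H_{l,m}(\boldsymbol{\alpha})$ is $\{\mathbf 0\}$ if $m\leq c_1$; is $\{B_1A_1:\deg B_1\leq m-c_1-1\}$ if $c_1+1\leq m\leq c_2$; and is $\{B_1A_1+B_2A_2:\deg B_1\leq m-c_1-1,\ \deg B_2\leq m-c_2-1\}$ if $c_2+1\leq m\leq n+1$. Such polynomials always exist, and $\deg A_2=c_2$ if $\pi_1\geq1$. For $r\leq 1$ (where $A_2$ plays no role in the kernels) one sets $A_2:=0$ if $\boldsymbol{\alpha}=\mathbf 0$, $A_2:=1$ if $\boldsymbol{\alpha}\in\mathcal{L}_n(1,1,0)$, and $A_2:=T^{n+1}$ if $\boldsymbol{\alpha}\in\mathcal{L}_n(1,0,1)$. Characteristic polynomials are normalised to be monic (when non-zero), and if $\pi_1=0$ then $A_2$ is chosen with $\deg A_2<\deg A_1$ (for $r=0$: $A_1=1$, $A_2=0$). *)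

theory Defs
  imports "Jordan_Normal_Form.DL_Rank" "Jordan_Normal_Form.Matrix_Kernel"
begin

definition n1 :: "nat \<Rightarrow> nat" where
  "n1 n = (n + 2) div 2"

definition n2 :: "nat \<Rightarrow> nat" where
  "n2 n = (n + 3) div 2"

text \<open>A sequence (alpha_0, ..., alpha_n) is a vector in \<^term>\<open>carrier_vec (n + 1)\<close>.
  Indices start at 0, so the (i, j) entry is alpha_(i+j).  This is only meaningful for
  \<open>l + m - 2 \<le> n\<close>, which is the case in all uses below.\<close>

definition hankel :: "nat \<Rightarrow> nat \<Rightarrow> 'a vec \<Rightarrow> 'a mat" where
  "hankel l m \<alpha> = mat l m (\<lambda>(i, j). \<alpha> $ (i + j))"

definition hankel_rank :: "nat \<Rightarrow> 'a::field vec \<Rightarrow> nat" where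
  "hankel_rank n \<alpha> = vec_space.rank (n1 n) (hankel (n1 n) (n2 n) \<alpha>)"

definition hankel_rho :: "nat \<Rightarrow> 'a::field vec \<Rightarrow> nat" where
  "hankel_rho n \<alpha> = Max (insert 0 {l \<in> {1..n1 n}. det (hankel l l \<alpha>) \<noteq> 0})"

text \<open>The subtraction does not truncate: the \<open>\<rho> \<times> \<rho>\<close> Hankel matrix, which is nonsingular, is a
  submatrix of the \<open>n1 \<times> n2\<close> one.\<close>

definition hankel_pi :: "nat \<Rightarrow> 'a::field vec \<Rightarrow> nat" where
  "hankel_pi n \<alpha> = hankel_rank n \<alpha> - hankel_rho n \<alpha>"

definition hankel_class :: "nat \<Rightarrow> nat \<Rightarrow> nat \<Rightarrow> nat \<Rightarrow> 'a::field vec set" where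
  "hankel_class n r \<rho>\<^sub>1 \<pi>\<^sub>1 =
    {\<alpha> \<in> carrier_vec (n + 1). hankel_rank n \<alpha> = r \<and> hankel_rho n \<alpha> = \<rho>\<^sub>1 \<and> hankel_pi n \<alpha> = \<pi>\<^sub>1}"

definition char_deg1 :: "nat \<Rightarrow> 'a::field vec \<Rightarrow> nat" where
  "char_deg1 n \<alpha> = hankel_rank n \<alpha>"

definition char_deg2 :: "nat \<Rightarrow> 'a::field vec \<Rightarrow> nat" where
  "char_deg2 n \<alpha> = n + 2 - hankel_rank n \<alpha>"

text \<open>The vector (v_0, ..., v_(m-1)) as the polynomial v_0 + v_1 T + ... + v_(m-1) T^(m-1).\<close>

definition vec_poly :: "'a::zero vec \<Rightarrow> 'a poly" where
  "vec_poly v = Poly (list_of_vec v)"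

text \<open>The degree of the zero polynomial is \<open>-\<infinity>\<close> in the source and 0 in the library.  Upper
  bounds by a natural number are unaffected; strict ones need the following relation.\<close>

definition degree_less :: "'a::zero poly \<Rightarrow> 'a poly \<Rightarrow> bool" where
  "degree_less p q \<longleftrightarrow> q \<noteq> 0 \<and> (p = 0 \<or> degree p < degree q)"

text \<open>Under the guards on \<open>m\<close> the subtractions in the degree bounds do not truncate.\<close>

definition kernel_structure :: "nat \<Rightarrow> 'a::field vec \<Rightarrow> 'a poly \<Rightarrow> 'a poly \<Rightarrow> bool" where
  "kernel_structure n \<alpha> A1 A2 \<longleftrightarrow>
    (\<forall>l m. l \<ge> 1 \<longrightarrow> m \<ge> 1 \<longrightarrow> l + m = n + 2 \<longrightarrow>
      (let c1 = char_deg1 n \<alpha>; c2 = char_deg2 n \<alpha>; K = vec_poly ` mat_kernel (hankel l m \<alpha>) in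
        (m \<le> c1 \<longrightarrow> K = {0}) \<and>
        (c1 + 1 \<le> m \<and> m \<le> c2 \<longrightarrow> K = {B1 * A1 | B1. degree B1 \<le> m - c1 - 1}) \<and>
        (c2 + 1 \<le> m \<and> m \<le> n + 1 \<longrightarrow>
          K = {B1 * A1 + B2 * A2 | B1 B2. degree B1 \<le> m - c1 - 1 \<and> degree B2 \<le> m - c2 - 1})))"

text \<open>\<open>A1\<close>, \<open>A2\<close> are (normalised) characteristic polynomials of \<open>\<alpha>\<close>.  The last three clauses are
  the conventions for rank at most 1, where the kernels do not involve \<open>A2\<close>.\<close>

definition char_polys :: "nat \<Rightarrow> 'a::field vec \<Rightarrow> 'a poly \<Rightarrow> 'a poly \<Rightarrow> bool" where
  "char_polys n \<alpha> A1 A2 \<longleftrightarrow>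
    coprime A1 A2 \<and>
    A1 \<noteq> 0 \<and> degree A1 = hankel_rho n \<alpha> \<and> degree A2 \<le> char_deg2 n \<alpha> \<and>
    kernel_structure n \<alpha> A1 A2 \<and>
    lead_coeff A1 = 1 \<and> (A2 \<noteq> 0 \<longrightarrow> lead_coeff A2 = 1) \<and>
    (hankel_pi n \<alpha> = 0 \<longrightarrow> degree_less A2 A1) \<and>
    (\<alpha> = 0\<^sub>v (n + 1) \<longrightarrow> A1 = 1 \<and> A2 = 0) \<and>
    (\<alpha> \<in> hankel_class n 1 1 0 \<longrightarrow> A2 = 1) \<and>
    (\<alpha> \<in> hankel_class n 1 0 1 \<longrightarrow> A2 = monom 1 (n + 1))"

definition extend_seq :: "'a vec \<Rightarrow> 'a \<Rightarrow> 'a vec" where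
  "extend_seq \<alpha> a = \<alpha> @\<^sub>v vec 1 (\<lambda>_. a)"

end

theory Submission
  imports Defs
begin

text \<open>
  View a sequence \<open>\<alpha>\<close> as the linear form \<open>\<phi>\<close> on polynomials with \<open>\<phi>(T^i) = \<alpha>_i\<close>.  Then the kernel of
  the Hankel matrix with \<open>m\<close> columns is the space \<open>K_m\<close> of all \<open>v\<close> with \<open>deg v < m\<close> and
  \<open>\<phi>(T^i v) = 0\<close> for every shift \<open>i\<close> that stays inside the sequence.  The characteristic polynomials say
  that \<open>K_m\<close> consists of the combinations \<open>B1 A1 + B2 A2\<close> with \<open>deg B1 < m - c1\<close> and
  \<open>deg B2 < m - c2\<close>; with \<open>deg B < 0\<close> meaning \<open>B = 0\<close> this one formula covers all three ranges of \<open>m\<close>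
  (\<open>kernel_structure_iff_generators\<close>).

  Appending \<open>a\<close> to \<open>\<alpha>\<close> adds a single condition, \<open>\<phi>'(T^(n+2-m) v) = 0\<close>, to those that define \<open>K_m\<close>.  On
  \<open>B1 A1 + B2 A2\<close> it only sees the coefficients \<open>b1\<close>, \<open>b2\<close> of \<open>B1\<close>, \<open>B2\<close> at the largest degrees allowed
  for them, and reads \<open>b1 \<delta>1 + b2 \<delta>2 = 0\<close>, where the discrepancies \<open>\<delta>1\<close>, \<open>\<delta>2\<close> are the values of \<open>\<phi>'\<close> at
  \<open>T^(c2-1) A1\<close> and \<open>T^(c1-1) A2\<close> (\<open>hankel_kernel_extend_generators\<close>); for \<open>c1 = 0\<close> one has
  \<open>B2 = 0\<close>, and \<open>\<delta>2 = 1\<close> serves.  If \<open>\<delta>1 = 0 \<noteq> \<delta>2\<close>, the condition is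
  \<open>b2 = 0\<close>: both generators stay and \<open>c2\<close> grows (\<open>generators_extend_regular\<close>).  If \<open>\<delta>1 \<noteq> 0\<close>, a
  combination of \<open>A2\<close> and \<open>T^(c2-c1) A1\<close> with discrepancy \<open>0\<close> replaces \<open>A2\<close>, and \<open>c1\<close> grows
  (\<open>generators_extend_jump\<close>); for \<open>c1 = c2\<close> the two generators can exchange
  their roles.  This is the step of the Berlekamp-Massey algorithm.

  The new entry \<open>a\<close> enters \<open>\<delta>1\<close> with the coefficient of \<open>T^c1\<close> in \<open>A1\<close>, and \<open>\<delta>2\<close> with that of
  \<open>T^c2\<close> in \<open>A2\<close>.  If \<open>\<pi> = 0\<close>, then \<open>deg A1 = c1\<close> and \<open>deg A2 < c2\<close>, so that \<open>\<delta>1\<close> is \<open>a\<close> plus a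
  constant and \<open>\<delta>2\<close> is a nonzero constant; if \<open>\<pi> \<ge> 1\<close> it is the other way round.  In all cases the parameter \<open>\<beta>\<close> of the
  claims is the negated quotient of the two discrepancies, hence a bijective affine function of \<open>a\<close>.

  Finally the generators determine the invariants of a sequence: the rank is the smaller of the two
  degrees \<open>c1\<close>, \<open>c2\<close>, by counting the elements of one kernel over the finite field
  (\<open>hankel_rank_of_generators\<close>), and \<open>\<rho>\<close> is the degree of \<open>A1\<close> (\<open>hankel_rho_of_generators\<close>).
\<close>

section \<open>Rank and kernel size over a finite field\<close>

lemma (in kernel) rank_plus_kernel_dim: "vec_space.rank nr A + dim = nc"
proof -
  interpret W: vec_space "TYPE('a)" nr .
  have hom: "(\<lambda>v. A *\<^sub>v v) \<in> LinearCombinations.module_hom class_ring NC.V W.V"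
    using A by (auto simp: LinearCombinations.module_hom_def class_ring_simps module_vec_simps
        mult_add_distrib_mat_vec[OF A] mult_mat_vec[OF A])
  interpret T: linear_map class_ring NC.V W.V "\<lambda>v. A *\<^sub>v v"
    by unfold_locales (rule hom)
  have im: "T.imT = W.span (set (cols A))"
    using W.col_space_eq[OF A] A by (auto simp: T.im_def W.col_space_def)
  have ker: "T.kerT = mat_kernel A"
    using A by (auto simp: T.ker_def mat_kernel_def)
  show ?thesis
    using T.rank_nullity[OF NC.fin_dim] unfolding im ker W.rank_def
    by (simp add: NC.dim_is_n)
qed

lemma (in vectorspace) card_carrier_eq_power_dim:
  assumes "basis B" "finite B"
  shows "card (carrier V) = card (carrier K) ^ dim"
proof -
  have B: "B \<subseteq> carrier V" using assms(1) by (simp add: basis_def)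
  have uni: "\<exists>!c. c \<in> B \<rightarrow>\<^sub>E carrier K \<and> lincomb c B = v" if "v \<in> carrier V" for v
    using basis_criterion[OF assms(2) B] assms(1) that by blast
  have mem: "lincomb c B \<in> carrier V" if "c \<in> B \<rightarrow>\<^sub>E carrier K" for c
    using lincomb_closed[OF B] that by (simp add: PiE_def)
  have "inj_on (\<lambda>c. lincomb c B) (B \<rightarrow>\<^sub>E carrier K)"
    using uni mem by (auto simp: inj_on_def)
  moreover have "(\<lambda>c. lincomb c B) ` (B \<rightarrow>\<^sub>E carrier K) = carrier V"
    using uni mem by blast
  ultimately have "bij_betw (\<lambda>c. lincomb c B) (B \<rightarrow>\<^sub>E carrier K) (carrier V)"
    by (simp add: bij_betw_def)
  then show ?thesis
    using assms by (simp add: bij_betw_same_card[symmetric] card_PiE dim_basis)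
qed

text \<open>Counting the kernel determines its dimension, since the field has more than one
  element; no basis of the kernel has to be exhibited.\<close>

lemma rank_eq_of_card_kernel:
  fixes A :: "'a::{field,finite} mat"
  assumes A: "A \<in> carrier_mat nr nc"
    and card: "card (mat_kernel A) = card (UNIV :: 'a set) ^ (nc - r)" and "r \<le> nc"
  shows "vec_space.rank nr A = r"
proof -
  interpret kernel nr nc A by unfold_locales (rule A)
  obtain B where "finite B" "basis B" using kernel_basis_exists[OF A] by blast
  then have "card (mat_kernel A) = card (UNIV :: 'a set) ^ dim"
    using Ker.card_carrier_eq_power_dim[of B] by simp
  moreover have "card (UNIV :: 'a set) > 1"
    using card_mono[of "UNIV :: 'a set" "{0, 1}"] by simp
  ultimately have "dim = nc - r" using card by simp
  then show ?thesis using rank_plus_kernel_dim \<open>r \<le> nc\<close> by simp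
qed

section \<open>Polynomials of bounded degree\<close>

text \<open>An element of least degree in the ideal generated by \<open>p\<close> and \<open>q\<close> divides both, hence
  is a unit. This argument needs no gcd on the polynomial ring and so works over every
  field.\<close>

lemma bezout_coprime_poly:
  fixes p q :: "'a::field poly"
  assumes "coprime p q"
  shows "\<exists>u v. u * p + v * q = 1"
proof -
  define I where "I = {u * p + v * q | u v. True}"
  have "1 * p + 0 * q \<in> I" "0 * p + 1 * q \<in> I" unfolding I_def by blast+
  then have pq: "p \<in> I" "q \<in> I" by simp_all
  have "p \<noteq> 0 \<or> q \<noteq> 0" using assms by auto
  then have "\<exists>g. g \<in> I \<and> g \<noteq> 0" using pq by blast
  then obtain g where g: "g \<in> I" "g \<noteq> 0"
    and min: "\<And>h. h \<in> I \<and> h \<noteq> 0 \<Longrightarrow> degree g \<le> degree h"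
    using arg_min_nat_lemma[of "\<lambda>h. h \<in> I \<and> h \<noteq> 0" _ degree] by blast
  obtain u v where uv: "g = u * p + v * q" using g(1) unfolding I_def by blast
  have dvd: "g dvd h" if h: "h \<in> I" for h
  proof -
    obtain x y where xy: "h = x * p + y * q" using h unfolding I_def by blast
    have "h mod g = h - h div g * g" by (simp add: minus_div_mult_eq_mod)
    also have "\<dots> = (x - h div g * u) * p + (y - h div g * v) * q"
      by (subst (1) xy, subst (2) uv) (simp add: algebra_simps)
    finally have "h mod g \<in> I" unfolding I_def by blast
    then have "h mod g = 0"
      using min[of "h mod g"] degree_mod_less[OF g(2), of h] by (cases "h mod g = 0") auto
    then show ?thesis by (simp add: mod_eq_0_iff_dvd)
  qed
  have "g dvd 1"
    by (rule coprime_common_divisor[OF assms dvd[OF pq(1)] dvd[OF pq(2)]])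
  then obtain k where k: "1 = g * k" by (rule dvdE)
  have "(k * u) * p + (k * v) * q = g * k" unfolding uv by (simp add: algebra_simps)
  then have "(k * u) * p + (k * v) * q = 1" using k by simp
  then show ?thesis by blast
qed

text \<open>The space in which \<open>deg p < k\<close> with \<open>deg 0 = -\<infinity>\<close>; for \<open>k = 0\<close> it is \<open>{0}\<close>, as the
  truncated subtractions \<open>m - c\<close> below require.\<close>

definition polys_below :: "nat \<Rightarrow> 'a::zero poly set" where
  "polys_below k = {p. \<forall>i\<ge>k. coeff p i = 0}"

lemma polys_below_iff: "p \<in> polys_below k \<longleftrightarrow> p = 0 \<or> degree p < k"
proof
  assume p: "p \<in> polys_below k"
  show "p = 0 \<or> degree p < k"
  proof (rule ccontr)
    assume *: "\<not> (p = 0 \<or> degree p < k)"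
    then have "lead_coeff p = 0" using p by (simp add: polys_below_def)
    then show False using * by simp
  qed
qed (auto simp: polys_below_def coeff_eq_0)

lemma polys_below_0 [simp]: "polys_below 0 = {0}"
  by (auto simp: polys_below_iff)

lemma zero_in_polys_below [simp]: "0 \<in> polys_below k"
  by (simp add: polys_below_iff)

lemma polys_below_Suc_iff: "p \<in> polys_below (Suc k) \<longleftrightarrow> degree p \<le> k"
  by (auto simp: polys_below_iff)

lemma polys_below_mono: "p \<in> polys_below k \<Longrightarrow> k \<le> k' \<Longrightarrow> p \<in> polys_below k'"
  by (auto simp: polys_below_def)

lemma polys_below_add: "p \<in> polys_below k \<Longrightarrow> q \<in> polys_below k \<Longrightarrow> p + q \<in> polys_below k"
  by (auto simp: polys_below_def)

lemma polys_below_diff: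
  fixes p q :: "'a::ab_group_add poly"
  shows "p \<in> polys_below k \<Longrightarrow> q \<in> polys_below k \<Longrightarrow> p - q \<in> polys_below k"
  by (auto simp: polys_below_def)

lemma polys_below_smult: "p \<in> polys_below k \<Longrightarrow> Polynomial.smult c p \<in> polys_below k"
  by (auto simp: polys_below_def)

lemma polys_below_monom_mult:
  fixes p :: "'a::comm_semiring_1 poly"
  assumes "p \<in> polys_below k"
  shows "monom c i * p \<in> polys_below (i + k)"
  using assms by (auto simp: polys_below_def coeff_monom_mult)

lemma polys_below_mult:
  fixes p q :: "'a::idom poly"
  assumes "p \<in> polys_below (Suc k)" "q \<in> polys_below l"
  shows "p * q \<in> polys_below (k + l)"
  using assms degree_mult_le[of p q] by (auto simp: polys_below_iff)

lemma polys_below_pred_iff: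
  "p \<in> polys_below (k - 1) \<longleftrightarrow> p \<in> polys_below k \<and> coeff p (k - 1) = 0"
  by (cases k) (auto simp: polys_below_def not_less_eq_eq le_Suc_eq dest: le_antisym, metis Suc_leI le_neq_implies_less)

lemma poly_as_sum_below: "p \<in> polys_below k \<Longrightarrow> p = (\<Sum>i<k. monom (coeff p i) i)"
  by (rule poly_eqI) (auto simp: coeff_sum polys_below_def not_less)

lemma card_polys_below:
  "card (polys_below k :: 'a::{zero,finite} poly set) = card (UNIV :: 'a set) ^ k"
proof -
  have "bij_betw (\<lambda>p. \<lambda>i\<in>{..<k}. coeff p i) (polys_below k :: 'a poly set) ({..<k} \<rightarrow>\<^sub>E UNIV)"
  proof (rule bij_betwI[where g = "\<lambda>f. Poly (map f [0..<k])"])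
    show "(\<lambda>p. \<lambda>i\<in>{..<k}. coeff p i) \<in> polys_below k \<rightarrow> ({..<k} \<rightarrow>\<^sub>E (UNIV :: 'a set))" by simp
    show "(\<lambda>f. Poly (map f [0..<k])) \<in> ({..<k} \<rightarrow>\<^sub>E (UNIV :: 'a set)) \<rightarrow> polys_below k"
      by (auto simp: polys_below_def nth_default_def)
  next
    fix p :: "'a poly" assume "p \<in> polys_below k"
    then show "Poly (map (\<lambda>i\<in>{..<k}. coeff p i) [0..<k]) = p"
      by (intro poly_eqI) (auto simp: nth_default_def polys_below_def)
  next
    fix f :: "nat \<Rightarrow> 'a" assume "f \<in> {..<k} \<rightarrow>\<^sub>E UNIV"
    then show "(\<lambda>i\<in>{..<k}. coeff (Poly (map f [0..<k])) i) = f"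
      by (auto simp: fun_eq_iff nth_default_def PiE_def extensional_def)
  qed
  then show ?thesis by (simp add: bij_betw_same_card card_PiE)
qed

section \<open>Hankel kernels as spaces of polynomials\<close>

text \<open>The linear form \<open>T^i \<mapsto> \<alpha>_i\<close>, extended by \<open>0\<close> to the powers beyond the sequence.\<close>

definition hankel_form :: "'a::comm_semiring_0 vec \<Rightarrow> 'a poly \<Rightarrow> 'a" where
  "hankel_form \<alpha> p = (\<Sum>i<dim_vec \<alpha>. coeff p i * \<alpha> $ i)"

lemma hankel_form_0 [simp]: "hankel_form \<alpha> 0 = 0"
  by (simp add: hankel_form_def)

lemma hankel_form_add: "hankel_form \<alpha> (p + q) = hankel_form \<alpha> p + hankel_form \<alpha> q"
  by (simp add: hankel_form_def distrib_right sum.distrib)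

lemma hankel_form_diff:
  fixes \<alpha> :: "'a::comm_ring vec"
  shows "hankel_form \<alpha> (p - q) = hankel_form \<alpha> p - hankel_form \<alpha> q"
  by (simp add: hankel_form_def left_diff_distrib sum_subtractf)

lemma hankel_form_smult: "hankel_form \<alpha> (Polynomial.smult c p) = c * hankel_form \<alpha> p"
  by (simp add: hankel_form_def sum_distrib_left mult.assoc)

lemma hankel_form_sum: "hankel_form \<alpha> (\<Sum>i\<in>I. f i) = (\<Sum>i\<in>I. hankel_form \<alpha> (f i))"
  by (induction I rule: infinite_finite_induct) (auto simp: hankel_form_add)

lemma hankel_form_monom:
  fixes \<alpha> :: "'a::comm_semiring_1 vec"
  shows "i < dim_vec \<alpha> \<Longrightarrow> hankel_form \<alpha> (monom 1 i) = \<alpha> $ i"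
  by (simp add: hankel_form_def if_distrib[of "\<lambda>c. c * _"] cong: if_cong)

lemma hankel_form_extend:
  "hankel_form (extend_seq \<alpha> a) p = hankel_form \<alpha> p + coeff p (dim_vec \<alpha>) * a"
  by (simp add: hankel_form_def extend_seq_def)

lemma dim_extend_seq [simp]: "dim_vec (extend_seq \<alpha> a) = Suc (dim_vec \<alpha>)"
  by (simp add: extend_seq_def)

text \<open>The bound \<open>i + m \<le> dim_vec \<alpha>\<close> keeps \<open>T^i v\<close> within the degrees on which \<open>\<alpha>\<close> is
  defined; for \<open>m = dim_vec \<alpha> + 1\<close> no condition is left. The Hankel matrix in question has
  \<open>dim_vec \<alpha> + 1 - m\<close> rows.\<close>

definition hankel_kernel :: "'a::comm_semiring_1 vec \<Rightarrow> nat \<Rightarrow> 'a poly set" where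
  "hankel_kernel \<alpha> m =
     {v \<in> polys_below m. \<forall>i. i + m \<le> dim_vec \<alpha> \<longrightarrow> hankel_form \<alpha> (monom 1 i * v) = 0}"

lemma hankel_form_shift_mult:
  fixes \<alpha> :: "'a::comm_ring_1 vec"
  assumes "B \<in> polys_below k"
  shows "hankel_form \<alpha> (monom 1 s * (B * A))
    = (\<Sum>i<k. coeff B i * hankel_form \<alpha> (monom 1 (s + i) * A))"
proof -
  have "monom 1 s * (B * A) = monom 1 s * ((\<Sum>i<k. monom (coeff B i) i) * A)"
    using poly_as_sum_below[OF assms] by metis
  also have "\<dots> = (\<Sum>i<k. Polynomial.smult (coeff B i) (monom 1 (s + i) * A))"
    by (simp add: sum_distrib_left sum_distrib_right mult.assoc[symmetric] mult_monom
        mult_smult_left[symmetric] smult_monom)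
  finally show ?thesis by (simp add: hankel_form_sum hankel_form_smult)
qed

lemma coeff_vec_poly: "coeff (vec_poly v) i = (if i < dim_vec v then v $ i else 0)"
  by (simp add: vec_poly_def nth_default_def list_of_vec_index)

lemma inj_on_vec_poly: "inj_on vec_poly (carrier_vec m)"
proof (intro inj_onI eq_vecI)
  fix x y :: "'a vec" and i
  assume "x \<in> carrier_vec m" "y \<in> carrier_vec m" "vec_poly x = vec_poly y" and i: "i < dim_vec y"
  then show "x $ i = y $ i" using coeff_vec_poly[of x i] coeff_vec_poly[of y i] by simp
qed auto

text \<open>A row of a Hankel matrix is a shift of the sequence, so that applying it to \<open>v\<close>
  evaluates the form at a shift of the polynomial of \<open>v\<close>.\<close>

lemma hankel_mult_vec_index:
  fixes \<alpha> :: "'a::comm_ring_1 vec"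
  assumes "l + m \<le> dim_vec \<alpha> + 1" "v \<in> carrier_vec m" "i < l"
  shows "(hankel l m \<alpha> *\<^sub>v v) $ i = hankel_form \<alpha> (monom 1 i * vec_poly v)"
proof -
  have "hankel_form \<alpha> (monom 1 i * vec_poly v)
      = (\<Sum>j<dim_vec \<alpha>. if i \<le> j \<and> j - i < m then v $ (j - i) * \<alpha> $ j else 0)"
    using assms(2) by (auto simp: hankel_form_def coeff_monom_mult coeff_vec_poly intro!: sum.cong)
  also have "\<dots> = (\<Sum>j\<in>{i..<i + m}. v $ (j - i) * \<alpha> $ j)"
    using assms by (intro sum.mono_neutral_cong_right) auto
  also have "\<dots> = (\<Sum>j<m. v $ j * \<alpha> $ (i + j))"
    by (rule sum.reindex_bij_witness[of _ "\<lambda>j. i + j" "\<lambda>j. j - i"]) auto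
  also have "\<dots> = (hankel l m \<alpha> *\<^sub>v v) $ i"
    using assms by (auto simp: hankel_def scalar_prod_def row_def mult.commute
        lessThan_atLeast0 intro!: sum.cong)
  finally show ?thesis by simp
qed

lemma vec_poly_mat_kernel_hankel:
  fixes \<alpha> :: "'a::comm_ring_1 vec"
  assumes "l + m \<le> dim_vec \<alpha> + 1"
  shows "vec_poly ` mat_kernel (hankel l m \<alpha>)
    = {v \<in> polys_below m. \<forall>i<l. hankel_form \<alpha> (monom 1 i * v) = 0}"
proof -
  have *: "v \<in> mat_kernel (hankel l m \<alpha>) \<longleftrightarrow>
      v \<in> carrier_vec m \<and> (\<forall>i<l. hankel_form \<alpha> (monom 1 i * vec_poly v) = 0)" for v
    using hankel_mult_vec_index[OF assms, of v]
    by (auto simp: mat_kernel_def hankel_def[of l m] vec_eq_iff)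
  have "p \<in> vec_poly ` carrier_vec m" if "p \<in> polys_below m" for p :: "'a poly"
  proof
    show "p = vec_poly (vec m (coeff p))"
      using that by (auto simp: poly_eq_iff coeff_vec_poly polys_below_def)
  qed simp
  moreover have "vec_poly v \<in> polys_below m" if "v \<in> carrier_vec m" for v :: "'a vec"
    using that by (auto simp: polys_below_def coeff_vec_poly)
  ultimately show ?thesis by (fastforce simp: *)
qed

lemma hankel_kernel_eq:
  fixes \<alpha> :: "'a::comm_ring_1 vec"
  assumes "l + m = dim_vec \<alpha> + 1"
  shows "vec_poly ` mat_kernel (hankel l m \<alpha>) = hankel_kernel \<alpha> m"
proof -
  have "i < l \<longleftrightarrow> i + m \<le> dim_vec \<alpha>" for i using assms by auto
  then show ?thesis
    using vec_poly_mat_kernel_hankel[of l m \<alpha>] assms by (simp add: hankel_kernel_def)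
qed

text \<open>Of the conditions for the longer sequence, only the one with the largest shift
  involves the new entry; the others are those for \<open>\<alpha>\<close>.\<close>

lemma hankel_kernel_extend:
  fixes \<alpha> :: "'a::comm_ring_1 vec"
  assumes "m \<le> dim_vec \<alpha> + 1"
  shows "hankel_kernel (extend_seq \<alpha> a) m = {v \<in> hankel_kernel \<alpha> m.
     hankel_form (extend_seq \<alpha> a) (monom 1 (dim_vec \<alpha> + 1 - m) * v) = 0}"
proof -
  have "hankel_form (extend_seq \<alpha> a) (monom 1 i * v) = hankel_form \<alpha> (monom 1 i * v)"
    if "v \<in> polys_below m" "i + m \<le> dim_vec \<alpha>" for i and v :: "'a poly"
    using polys_below_monom_mult[OF that(1), of 1 i] that(2)
    by (simp add: hankel_form_extend polys_below_def)
  moreover have "i + m \<le> Suc (dim_vec \<alpha>) \<longleftrightarrow> i + m \<le> dim_vec \<alpha> \<or> i = dim_vec \<alpha> + 1 - m" for i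
    using assms by auto
  ultimately show ?thesis by (auto simp: hankel_kernel_def)
qed

section \<open>Generators of the kernels and their extension\<close>

text \<open>The combinations of weighted degree below \<open>m\<close>, where \<open>A1\<close> and \<open>A2\<close> have the weights
  \<open>c1\<close> and \<open>c2\<close>, which may exceed their degrees.\<close>

definition graded_span :: "'a::comm_semiring_0 poly \<Rightarrow> nat \<Rightarrow> 'a poly \<Rightarrow> nat \<Rightarrow> nat \<Rightarrow> 'a poly set" where
  "graded_span A1 c1 A2 c2 m =
     {B1 * A1 + B2 * A2 | B1 B2. B1 \<in> polys_below (m - c1) \<and> B2 \<in> polys_below (m - c2)}"

lemma graded_span_commute: "graded_span A1 c1 A2 c2 = graded_span A2 c2 A1 c1"
proof -
  have "graded_span A1 c1 A2 c2 m \<subseteq> graded_span A2 c2 A1 c1 m" for A1 A2 :: "'a poly" and c1 c2 m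
    unfolding graded_span_def by (clarify, subst add.commute) blast
  then show ?thesis by (intro ext equalityI)
qed

lemma graded_span_left:
  "m \<le> c2 \<Longrightarrow> graded_span A1 c1 A2 c2 m = {B * A1 | B. B \<in> polys_below (m - c1)}"
  by (simp add: graded_span_def)

lemma graded_span_zero: "m \<le> c1 \<Longrightarrow> m \<le> c2 \<Longrightarrow> graded_span A1 c1 A2 c2 m = {0}"
  by (simp add: graded_span_def)

text \<open>The pairs \<open>(A1, c1)\<close> and \<open>(A2, c2)\<close> enter symmetrically: neither \<open>c1 \<le> c2\<close> nor a
  normalisation is part of the definition, so that the roles can be exchanged when an
  extension makes the second generator the first one.\<close>

definition hankel_generators ::
    "'a::comm_semiring_1 vec \<Rightarrow> 'a poly \<Rightarrow> nat \<Rightarrow> 'a poly \<Rightarrow> nat \<Rightarrow> bool" where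
  "hankel_generators \<alpha> A1 c1 A2 c2 \<longleftrightarrow> c1 + c2 = dim_vec \<alpha> + 1 \<and>
     (\<forall>m\<le>dim_vec \<alpha>. hankel_kernel \<alpha> m = graded_span A1 c1 A2 c2 m)"

lemma hankel_generators_commute:
  "hankel_generators \<alpha> A1 c1 A2 c2 \<longleftrightarrow> hankel_generators \<alpha> A2 c2 A1 c1"
  unfolding hankel_generators_def by (metis add.commute graded_span_commute)

lemma hankel_generators_kernelD:
  "hankel_generators \<alpha> A1 c1 A2 c2 \<Longrightarrow> m \<le> dim_vec \<alpha> \<Longrightarrow>
    hankel_kernel \<alpha> m = graded_span A1 c1 A2 c2 m"
  by (simp add: hankel_generators_def)

text \<open>A Bezout relation gives \<open>p = X A1 + Y A2\<close>; reducing \<open>Y\<close> modulo \<open>A1\<close> makes \<open>Y A2\<close> of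
  degree below \<open>c1 + c2\<close>, which then bounds \<open>X\<close>. This is the formula for the kernel in the
  case \<open>m = dim_vec \<alpha> + 1\<close>, which the definition of the generators leaves out and the
  extension step uses.\<close>

lemma polys_below_subset_graded_span:
  fixes A1 A2 :: "'a::field poly"
  assumes "coprime A1 A2" "A1 \<noteq> 0" "degree A1 = c1" "degree A2 \<le> c2"
  shows "polys_below (c1 + c2) \<subseteq> graded_span A1 c1 A2 c2 (c1 + c2)"
proof
  fix p :: "'a poly" assume p: "p \<in> polys_below (c1 + c2)"
  obtain u v where uv: "u * A1 + v * A2 = 1" using bezout_coprime_poly[OF assms(1)] by blast
  define d where "d = (p * v) div A1"
  define Y where "Y = (p * v) mod A1"
  define X where "X = p * u + d * A2"
  have Y_eq: "Y = p * v - d * A1" unfolding Y_def d_def by (simp add: minus_div_mult_eq_mod)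
  have "X * A1 + Y * A2 = p * (u * A1 + v * A2)"
    unfolding X_def Y_eq by (simp add: algebra_simps)
  then have eq: "X * A1 + Y * A2 = p" using uv by simp
  have Y: "Y \<in> polys_below c1"
    using degree_mod_less[OF assms(2), of "p * v"] assms(3) by (auto simp: Y_def polys_below_iff)
  have "Y * A2 \<in> polys_below (c1 + c2)"
    using polys_below_mult[of A2 c2 Y c1] Y assms(4)
    by (simp add: polys_below_Suc_iff mult.commute add.commute)
  then have "X * A1 \<in> polys_below (c1 + c2)"
    using polys_below_diff[OF p, of "Y * A2"] eq by (simp add: algebra_simps flip: eq)
  then have "X \<in> polys_below c2"
    using assms(2,3) degree_mult_eq[of X A1] by (cases "X = 0") (simp_all add: polys_below_iff)
  then show "p \<in> graded_span A1 c1 A2 c2 (c1 + c2)"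
    unfolding graded_span_def using eq[symmetric] Y by simp blast
qed

text \<open>Only the term of \<open>B\<close> of degree \<open>k - 1\<close> reaches the one shift of \<open>A\<close> at which the form
  need not vanish. For \<open>k = 0\<close> both sides vanish because \<open>B = 0\<close>.\<close>

lemma hankel_form_shifted_multiple:
  fixes \<alpha> :: "'a::comm_ring_1 vec"
  assumes A: "\<And>i. i < c \<Longrightarrow> hankel_form \<alpha> (monom 1 i * A) = (if Suc i = c then \<delta> else 0)"
    and B: "B \<in> polys_below k" and "k = 0 \<or> s + k = c"
  shows "hankel_form \<alpha> (monom 1 s * (B * A)) = coeff B (k - 1) * \<delta>"
proof (cases k)
  case 0
  then show ?thesis using B by simp
next
  case (Suc j)
  then have "hankel_form \<alpha> (monom 1 s * (B * A)) = (\<Sum>i<Suc j. if i = j then coeff B i * \<delta> else 0)"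
    unfolding hankel_form_shift_mult[OF B] using A assms(3) by (intro sum.cong) auto
  then show ?thesis using Suc by simp
qed

text \<open>The condition that the new entry adds to the kernel, expressed in the coefficients of
  a combination of the generators. The hypothesis on \<open>\<delta>2\<close> is vacuous for \<open>c1 = 0\<close>, and \<open>\<delta>2\<close>
  can then be chosen freely.\<close>

lemma hankel_kernel_extend_generators:
  fixes \<alpha> :: "'a::comm_ring_1 vec"
  defines "N \<equiv> dim_vec \<alpha> + 1"
  assumes gen: "hankel_generators \<alpha> A1 c1 A2 c2"
    and full: "polys_below N \<subseteq> graded_span A1 c1 A2 c2 N"
    and deg: "degree A1 \<le> c1" "degree A2 \<le> c2"
    and A1: "\<And>i. i < c2 \<Longrightarrow> hankel_form (extend_seq \<alpha> a) (monom 1 i * A1) = (if Suc i = c2 then \<delta>1 else 0)"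
    and A2: "\<And>i. i < c1 \<Longrightarrow> hankel_form (extend_seq \<alpha> a) (monom 1 i * A2) = (if Suc i = c1 then \<delta>2 else 0)"
    and "m \<le> N"
  shows "hankel_kernel (extend_seq \<alpha> a) m = {B1 * A1 + B2 * A2 | B1 B2.
    B1 \<in> polys_below (m - c1) \<and> B2 \<in> polys_below (m - c2) \<and>
    coeff B1 (m - c1 - 1) * \<delta>1 + coeff B2 (m - c2 - 1) * \<delta>2 = 0}"
proof -
  have N: "c1 + c2 = N" using gen by (simp add: hankel_generators_def N_def)
  have K: "hankel_kernel \<alpha> m = graded_span A1 c1 A2 c2 m"
  proof (cases "m = N")
    case True
    have "graded_span A1 c1 A2 c2 N \<subseteq> polys_below N"
    proof
      fix p assume "p \<in> graded_span A1 c1 A2 c2 N"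
      then obtain B1 B2 where p: "p = B1 * A1 + B2 * A2"
        and B: "B1 \<in> polys_below c2" "B2 \<in> polys_below c1"
        using N by (auto simp: graded_span_def)
      have below: "B * A \<in> polys_below (c + k)"
        if "B \<in> polys_below k" "degree A \<le> c" for A B :: "'a poly" and k c
        using that degree_mult_le[of B A] by (auto simp: polys_below_iff)
      have "B1 * A1 \<in> polys_below N" "B2 * A2 \<in> polys_below N"
        using below[OF B(1) deg(1)] below[OF B(2) deg(2)] N by (simp_all add: add.commute)
      then show "p \<in> polys_below N" unfolding p by (rule polys_below_add)
    qed
    then show ?thesis using True full by (auto simp: hankel_kernel_def N_def)
  next
    case False
    then show ?thesis using gen \<open>m \<le> N\<close> by (simp add: hankel_generators_def N_def)
  qed
  have form: "hankel_form (extend_seq \<alpha> a) (monom 1 (N - m) * (B1 * A1 + B2 * A2))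
      = coeff B1 (m - c1 - 1) * \<delta>1 + coeff B2 (m - c2 - 1) * \<delta>2"
    if "B1 \<in> polys_below (m - c1)" "B2 \<in> polys_below (m - c2)" for B1 B2
  proof -
    have "m - c1 = 0 \<or> (N - m) + (m - c1) = c2" "m - c2 = 0 \<or> (N - m) + (m - c2) = c1"
      using N \<open>m \<le> N\<close> by auto
    from hankel_form_shifted_multiple[OF A1 that(1) this(1)] hankel_form_shifted_multiple[OF A2 that(2) this(2)]
    show ?thesis by (simp add: hankel_form_add distrib_left)
  qed
  show ?thesis
    using \<open>m \<le> N\<close> form
    unfolding N_def hankel_kernel_extend[OF \<open>m \<le> N\<close>[unfolded N_def]] K graded_span_def
    by fastforce
qed

text \<open>The new condition says that the coefficient of \<open>B2\<close> at its largest allowed degree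
  vanishes, that is, that its degree bound drops by one.\<close>

lemma generators_extend_regular:
  fixes \<alpha> :: "'a::idom vec"
  assumes gen: "hankel_generators \<alpha> A1 c1 A2 c2"
    and full: "polys_below (c1 + c2) \<subseteq> graded_span A1 c1 A2 c2 (c1 + c2)"
    and deg: "degree A1 \<le> c1" "degree A2 \<le> c2"
    and A1: "\<And>i. i < c2 \<Longrightarrow> hankel_form (extend_seq \<alpha> a) (monom 1 i * A1) = 0"
    and A2: "\<And>i. i < c1 \<Longrightarrow> hankel_form (extend_seq \<alpha> a) (monom 1 i * A2) = (if Suc i = c1 then \<delta>2 else 0)"
    and "\<delta>2 \<noteq> 0"
  shows "hankel_generators (extend_seq \<alpha> a) A1 c1 A2 (c2 + 1)"
proof -
  have N: "c1 + c2 = dim_vec \<alpha> + 1" using gen by (simp add: hankel_generators_def)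
  have "hankel_kernel (extend_seq \<alpha> a) m = graded_span A1 c1 A2 (c2 + 1) m"
    if "m \<le> dim_vec \<alpha> + 1" for m
  proof -
    have "hankel_kernel (extend_seq \<alpha> a) m = {B1 * A1 + B2 * A2 | B1 B2.
      B1 \<in> polys_below (m - c1) \<and> B2 \<in> polys_below (m - c2) \<and>
      coeff B1 (m - c1 - 1) * 0 + coeff B2 (m - c2 - 1) * \<delta>2 = 0}"
      by (rule hankel_kernel_extend_generators[OF gen _ deg _ A2 that]) (use full N A1 in auto)
    moreover have "B \<in> polys_below (m - (c2 + 1)) \<longleftrightarrow>
        B \<in> polys_below (m - c2) \<and> coeff B (m - c2 - 1) = 0" for B :: "'a poly"
      using polys_below_pred_iff[of B "m - c2"] by simp
    ultimately show ?thesis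
      using \<open>\<delta>2 \<noteq> 0\<close> by (simp add: graded_span_def)
  qed
  then show ?thesis using N by (simp add: hankel_generators_def)
qed

text \<open>The combination \<open>x A2 + y T^(c2-c1) A1\<close> has discrepancy \<open>x \<delta>2 + y \<delta>1 = 0\<close>. In terms of
  it and \<open>A1\<close>, the new condition says that the multiplier of \<open>A1\<close> has a zero coefficient at
  its largest allowed degree.\<close>

lemma generators_extend_jump:
  fixes \<alpha> :: "'a::field vec"
  assumes gen: "hankel_generators \<alpha> A1 c1 A2 c2" and "c1 \<le> c2"
    and full: "polys_below (c1 + c2) \<subseteq> graded_span A1 c1 A2 c2 (c1 + c2)"
    and deg: "degree A1 \<le> c1" "degree A2 \<le> c2"
    and A1: "\<And>i. i < c2 \<Longrightarrow> hankel_form (extend_seq \<alpha> a) (monom 1 i * A1) = (if Suc i = c2 then \<delta>1 else 0)"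
    and A2: "\<And>i. i < c1 \<Longrightarrow> hankel_form (extend_seq \<alpha> a) (monom 1 i * A2) = (if Suc i = c1 then \<delta>2 else 0)"
    and "\<delta>1 \<noteq> 0" "x \<noteq> 0" and xy: "x * \<delta>2 + y * \<delta>1 = 0"
  shows "hankel_generators (extend_seq \<alpha> a)
    A1 (c1 + 1) (Polynomial.smult x A2 + Polynomial.smult y (monom 1 (c2 - c1) * A1)) c2"
proof -
  define A2' where "A2' = Polynomial.smult x A2 + Polynomial.smult y (monom 1 (c2 - c1) * A1)"
  have N: "c1 + c2 = dim_vec \<alpha> + 1" using gen by (simp add: hankel_generators_def)
  have "hankel_kernel (extend_seq \<alpha> a) m = graded_span A1 (c1 + 1) A2' c2 m"
    if "m \<le> dim_vec \<alpha> + 1" for m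
  proof -
    have "hankel_kernel (extend_seq \<alpha> a) m = {B1 * A1 + B2 * A2 | B1 B2.
      B1 \<in> polys_below (m - c1) \<and> B2 \<in> polys_below (m - c2) \<and>
      coeff B1 (m - c1 - 1) * \<delta>1 + coeff B2 (m - c2 - 1) * \<delta>2 = 0}" (is "_ = ?K")
      by (rule hankel_kernel_extend_generators[OF gen _ deg A1 A2 that]) (use full N in auto)
    also have "?K = graded_span A1 (c1 + 1) A2' c2 m"
    proof (intro equalityI subsetI)
      have shift: "monom z (c2 - c1) * B \<in> polys_below (m - c1) \<and>
          coeff (monom z (c2 - c1) * B) (m - c1 - 1) = z * coeff B (m - c2 - 1)"
        if "B \<in> polys_below (m - c2)" for B :: "'a poly" and z
      proof (cases "m \<le> c2")
        case False
        then show ?thesis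
          using polys_below_monom_mult[OF that, of z "c2 - c1"] \<open>c1 \<le> c2\<close>
          by (auto simp: coeff_monom_mult)
      qed (use that in simp)
      {
        fix p assume "p \<in> ?K"
        then obtain B1 B2 where p: "p = B1 * A1 + B2 * A2"
          and B: "B1 \<in> polys_below (m - c1)" "B2 \<in> polys_below (m - c2)"
          and top: "coeff B1 (m - c1 - 1) * \<delta>1 + coeff B2 (m - c2 - 1) * \<delta>2 = 0" by auto
        \<comment> \<open>Solve \<open>A2' = x A2 + y T^(c2-c1) A1\<close> for \<open>A2\<close>.\<close>
        define B1' where "B1' = B1 - monom (y / x) (c2 - c1) * B2"
        define B2' where "B2' = Polynomial.smult (1 / x) B2"
        have "monom (y / x) (c2 - c1) = Polynomial.smult (y / x) (monom 1 (c2 - c1))"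
          by (simp add: smult_monom)
        then have "p = B1' * A1 + B2' * A2'"
          using \<open>x \<noteq> 0\<close> unfolding p B1'_def B2'_def A2'_def
          by (simp add: algebra_simps smult_add_right)
        moreover have "\<delta>2 = - (y / x) * \<delta>1"
          using xy \<open>x \<noteq> 0\<close> by (simp add: field_simps) (metis add_eq_0_iff add.commute)
        then have "coeff B1' (m - c1 - 1) * \<delta>1 = 0"
          using top shift[OF B(2), of "y / x"] unfolding B1'_def by (simp add: algebra_simps)
        then have "B1' \<in> polys_below (m - (c1 + 1))"
          using \<open>\<delta>1 \<noteq> 0\<close> polys_below_pred_iff[of B1' "m - c1"]
            polys_below_diff[OF B(1)] shift[OF B(2), of "y / x"] by (simp add: B1'_def)
        moreover have "B2' \<in> polys_below (m - c2)"
          unfolding B2'_def by (rule polys_below_smult[OF B(2)])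
        ultimately show "p \<in> graded_span A1 (c1 + 1) A2' c2 m"
          unfolding graded_span_def by blast
      next
        fix p assume "p \<in> graded_span A1 (c1 + 1) A2' c2 m"
        then obtain B1 B2 where p: "p = B1 * A1 + B2 * A2'"
          and B: "B1 \<in> polys_below (m - c1 - 1)" "B2 \<in> polys_below (m - c2)"
          by (auto simp: graded_span_def)
        define B1' where "B1' = B1 + monom y (c2 - c1) * B2"
        define B2' where "B2' = Polynomial.smult x B2"
        have "monom y (c2 - c1) = Polynomial.smult y (monom 1 (c2 - c1))"
          by (simp add: smult_monom)
        then have "p = B1' * A1 + B2' * A2"
          unfolding p B1'_def B2'_def A2'_def by (simp add: algebra_simps smult_add_right)
        moreover have "B1 \<in> polys_below (m - c1)" "coeff B1 (m - c1 - 1) = 0"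
          using B(1) polys_below_pred_iff[of B1 "m - c1"] by auto
        then have "B1' \<in> polys_below (m - c1)" "coeff B1' (m - c1 - 1) = y * coeff B2 (m - c2 - 1)"
          using shift[OF B(2), of y] by (auto simp: B1'_def polys_below_add)
        moreover have "B2' \<in> polys_below (m - c2)" "coeff B2' (m - c2 - 1) = x * coeff B2 (m - c2 - 1)"
          unfolding B2'_def using polys_below_smult[OF B(2)] by auto
        moreover have "y * coeff B2 (m - c2 - 1) * \<delta>1 + x * coeff B2 (m - c2 - 1) * \<delta>2
            = (x * \<delta>2 + y * \<delta>1) * coeff B2 (m - c2 - 1)" by (simp add: algebra_simps)
        ultimately show "p \<in> ?K" using xy by fastforce
      }
    qed
    finally show ?thesis .
  qed
  then show ?thesis using N by (simp add: hankel_generators_def A2'_def)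
qed

section \<open>Rank and nonsingular minors from the generators\<close>

lemma n1_plus_n2: "n1 n + n2 n = n + 2"
  by (auto simp: n1_def n2_def)

lemma card_mat_kernel_hankel:
  "l + m = dim_vec \<alpha> + 1 \<Longrightarrow> card (mat_kernel (hankel l m \<alpha>)) = card (hankel_kernel \<alpha> m)"
  for \<alpha> :: "'a::comm_ring_1 vec"
  by (subst hankel_kernel_eq[symmetric], assumption, subst card_image)
    (auto intro: inj_on_subset[OF inj_on_vec_poly[of m]] simp: mat_kernel_def hankel_def)

text \<open>The kernel with \<open>n2 n\<close> columns lies in the range where only \<open>A1\<close> contributes, so its
  elements correspond to the polynomials \<open>B\<close> with \<open>deg B < n2 n - c1\<close>.\<close>

lemma hankel_rank_of_generators:
  fixes \<alpha> :: "'a::{field,finite} vec"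
  assumes gen: "hankel_generators \<alpha> A1 c1 A2 c2" and "\<alpha> \<in> carrier_vec (n + 1)" "n \<ge> 1"
    and "c1 \<le> c2" "A1 \<noteq> 0"
  shows "hankel_rank n \<alpha> = c1"
proof -
  have dim: "dim_vec \<alpha> = n + 1" using assms(2) by simp
  have c: "c1 + c2 = n + 2" using gen dim by (simp add: hankel_generators_def)
  have n2: "c1 \<le> n2 n" "n2 n \<le> c2" "n2 n \<le> n + 1"
    using c \<open>c1 \<le> c2\<close> \<open>n \<ge> 1\<close> by (auto simp: n2_def)
  have "card (mat_kernel (hankel (n1 n) (n2 n) \<alpha>)) = card (hankel_kernel \<alpha> (n2 n))"
    using n1_plus_n2[of n] dim by (intro card_mat_kernel_hankel) simp
  also have "hankel_kernel \<alpha> (n2 n) = (\<lambda>B. B * A1) ` polys_below (n2 n - c1)"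
    using hankel_generators_kernelD[OF gen, of "n2 n"] n2 dim by (auto simp: graded_span_left)
  also have "card \<dots> = card (UNIV :: 'a set) ^ (n2 n - c1)"
    using \<open>A1 \<noteq> 0\<close> by (simp add: card_image inj_on_def card_polys_below)
  finally show ?thesis
    unfolding hankel_rank_def by (intro rank_eq_of_card_kernel) (use n2 in \<open>simp_all add: hankel_def\<close>)
qed

lemma det_hankel_eq_0_iff:
  fixes \<alpha> :: "'a::field vec"
  assumes "2 * l \<le> dim_vec \<alpha> + 1"
  shows "det (hankel l l \<alpha>) = 0 \<longleftrightarrow>
    (\<exists>v\<in>polys_below l. v \<noteq> 0 \<and> (\<forall>i<l. hankel_form \<alpha> (monom 1 i * v) = 0))"
proof -
  let ?H = "hankel l l \<alpha>"
  have H: "?H \<in> carrier_mat l l" by (simp add: hankel_def)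
  have "det ?H = 0 \<longleftrightarrow> (\<exists>v. v \<in> carrier_vec l \<and> v \<noteq> 0\<^sub>v l \<and> ?H *\<^sub>v v = 0\<^sub>v l)"
    by (rule det_0_iff_vec_prod_zero[OF H])
  also have "\<dots> \<longleftrightarrow> (\<exists>v\<in>mat_kernel ?H. v \<noteq> 0\<^sub>v l)"
    using mat_kernel[OF H] by auto
  also have "\<dots> \<longleftrightarrow> (\<exists>v\<in>mat_kernel ?H. vec_poly v \<noteq> 0)"
  proof -
    have "vec_poly v = 0 \<longleftrightarrow> v = 0\<^sub>v l" if "v \<in> carrier_vec l" for v :: "'a vec"
      using inj_onD[OF inj_on_vec_poly[of l], of v "0\<^sub>v l"] that
      by (auto simp: poly_eq_iff coeff_vec_poly)
    then show ?thesis using mat_kernelD(1)[OF H] by blast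
  qed
  also have "\<dots> \<longleftrightarrow> (\<exists>v\<in>vec_poly ` mat_kernel ?H. v \<noteq> 0)" by blast
  finally show ?thesis
    using vec_poly_mat_kernel_hankel[of l l \<alpha>] assms by auto
qed

lemma hankel_form_left_generator:
  fixes \<alpha> :: "'a::field vec"
  assumes gen: "hankel_generators \<alpha> A1 c1 A2 c2" and i: "Suc i < c2"
  shows "hankel_form \<alpha> (monom 1 i * A1) = 0"
proof -
  have c: "c1 + c2 = dim_vec \<alpha> + 1" using gen by (simp add: hankel_generators_def)
  have "A1 = 1 * A1 + 0 * A2" "(1 :: 'a poly) \<in> polys_below (c1 + 1 - c1)"
    by (simp_all add: polys_below_iff)
  then have "A1 \<in> graded_span A1 c1 A2 c2 (c1 + 1)"
    unfolding graded_span_def using zero_in_polys_below by blast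
  moreover have "hankel_kernel \<alpha> (c1 + 1) = graded_span A1 c1 A2 c2 (c1 + 1)"
    using hankel_generators_kernelD[OF gen] c i by simp
  ultimately have "A1 \<in> hankel_kernel \<alpha> (c1 + 1)" by simp
  then show ?thesis using c i by (simp add: hankel_kernel_def)
qed

text \<open>For \<open>l > deg A1\<close> the polynomial \<open>A1\<close> itself is a kernel vector of the square matrix of
  size \<open>l\<close>. For \<open>l = deg A1\<close>, the form vanishes at \<open>T^i v\<close> for every kernel vector \<open>v\<close> and
  \<open>i < c2\<close>, because \<open>T^i\<close> can be reduced modulo \<open>A1\<close> first; so \<open>v\<close> lies in the kernel with
  \<open>c1\<close> columns, which is trivial.\<close>

lemma hankel_rho_of_generators:
  fixes \<alpha> :: "'a::field vec"
  assumes gen: "hankel_generators \<alpha> A1 c1 A2 c2" and "\<alpha> \<in> carrier_vec (n + 1)" "n \<ge> 1"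
    and "c1 \<le> c2" "A1 \<noteq> 0" "degree A1 \<le> c1" and full: "c1 = c2 \<Longrightarrow> degree A1 = c1"
  shows "hankel_rho n \<alpha> = degree A1"
proof -
  have dim: "dim_vec \<alpha> = n + 1" using assms(2) by simp
  have c: "c1 + c2 = n + 2" using gen dim by (simp add: hankel_generators_def)
  then have n1: "c1 \<le> n1 n" "c1 < c2 \<Longrightarrow> n1 n < c2" using \<open>c1 \<le> c2\<close> by (auto simp: n1_def)
  have twice: "2 * l \<le> dim_vec \<alpha> + 1" if "l \<le> n1 n" for l using that by (auto simp: dim n1_def)
  have above: "det (hankel l l \<alpha>) = 0" if l: "degree A1 < l" "l \<le> n1 n" for l
  proof -
    have "c1 < c2" using l n1 full \<open>c1 \<le> c2\<close> c by (cases "c1 = c2") (auto simp: n1_def)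
    have "\<forall>i<l. hankel_form \<alpha> (monom 1 i * A1) = 0"
      using hankel_form_left_generator[OF gen] l n1(2)[OF \<open>c1 < c2\<close>] by auto
    then show ?thesis
      using det_hankel_eq_0_iff[OF twice[OF l(2)]] \<open>A1 \<noteq> 0\<close> l(1) by (auto simp: polys_below_iff)
  qed
  have at: "det (hankel (degree A1) (degree A1) \<alpha>) \<noteq> 0" (is "det (hankel ?d ?d _) \<noteq> 0")
  proof
    assume "det (hankel ?d ?d \<alpha>) = 0"
    then obtain v where v: "v \<in> polys_below ?d" "v \<noteq> 0"
      and zero: "\<And>i. i < ?d \<Longrightarrow> hankel_form \<alpha> (monom 1 i * v) = 0"
      using det_hankel_eq_0_iff[OF twice, of ?d] \<open>degree A1 \<le> c1\<close> n1(1) by auto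
    have "hankel_form \<alpha> (monom 1 i * v) = 0" if "i < c2" for i
    proof -
      \<comment> \<open>In \<open>T^i = w A1 + t\<close> the part \<open>t\<close> is covered by the choice of \<open>v\<close>, and \<open>w A1\<close> by the shifts of \<open>A1\<close>.\<close>
      define w where "w = monom 1 i div A1"
      define t where "t = monom 1 i mod A1"
      have eq: "monom 1 i * v = (w * v) * A1 + t * v"
      proof -
        have "monom 1 i = w * A1 + t" unfolding w_def t_def by simp
        then show ?thesis by (simp add: algebra_simps)
      qed
      have "t \<in> polys_below ?d"
        using degree_mod_less[OF \<open>A1 \<noteq> 0\<close>, of "monom 1 i"] by (auto simp: t_def polys_below_iff)
      then have "hankel_form \<alpha> (monom 1 0 * (t * v)) = 0"
        by (subst hankel_form_shift_mult) (auto simp: zero)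
      moreover have "hankel_form \<alpha> (monom 1 0 * ((w * v) * A1)) = 0"
      proof -
        have "w * v \<in> polys_below (c2 - 1)"
        proof (cases "w = 0")
          case False
          have "coeff (w * A1) (degree w + ?d) \<noteq> 0"
            using False \<open>A1 \<noteq> 0\<close> by (simp add: coeff_mult_degree_sum)
          moreover have "coeff t (degree w + ?d) = 0"
            using \<open>t \<in> polys_below ?d\<close> by (simp add: polys_below_def)
          ultimately have "coeff (w * A1 + t) (degree w + ?d) \<noteq> 0" by simp
          then have "degree w + ?d = i" by (simp add: w_def t_def split: if_splits)
          have "degree v < ?d" using v by (simp add: polys_below_iff)
          then show ?thesis
            using that degree_mult_eq[OF False v(2)] \<open>degree v < ?d\<close> \<open>degree w + ?d = i\<close>
            by (auto simp: polys_below_iff)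
        qed simp
        then show ?thesis
          by (subst hankel_form_shift_mult) (auto simp: hankel_form_left_generator[OF gen])
      qed
      ultimately show ?thesis by (simp add: eq hankel_form_add)
    qed
    moreover have "v \<in> polys_below c1" using v(1) \<open>degree A1 \<le> c1\<close> by (rule polys_below_mono)
    moreover have "c1 \<le> dim_vec \<alpha>" using c \<open>c1 \<le> c2\<close> \<open>n \<ge> 1\<close> dim by simp
    moreover have "i < c2" if "i + c1 \<le> dim_vec \<alpha>" for i using c dim that by simp
    ultimately have "v \<in> graded_span A1 c1 A2 c2 c1"
      using hankel_generators_kernelD[OF gen, of c1] by (auto simp: hankel_kernel_def)
    then show False using v(2) graded_span_zero[of c1 c1 c2 A1 A2] \<open>c1 \<le> c2\<close> by simp
  qed
  show ?thesis unfolding hankel_rho_def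
    using above at n1(1) \<open>degree A1 \<le> c1\<close>
    by (intro Max_eqI) (auto simp: not_less[symmetric] Suc_le_eq intro: finite_subset[of _ "{1..n1 n}"])
qed

section \<open>Characteristic polynomials as generators\<close>

lemma degree_le_iff_polys_below:
  "k < m \<Longrightarrow> degree p \<le> m - k - 1 \<longleftrightarrow> p \<in> polys_below (m - k)"
  by (auto simp: polys_below_iff)

text \<open>The three ranges of \<open>m\<close> are the cases of the single formula in which none, one or both
  of the degree bounds \<open>m - c1\<close>, \<open>m - c2\<close> are positive.\<close>

lemma kernel_structure_iff_generators:
  fixes \<alpha> :: "'a::field vec"
  assumes "\<alpha> \<in> carrier_vec (n + 1)" and rank: "hankel_rank n \<alpha> = c1" and c: "c1 + c2 = n + 2" "c1 \<le> c2"
  shows "kernel_structure n \<alpha> A1 A2 \<longleftrightarrow> hankel_generators \<alpha> A1 c1 A2 c2"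
proof -
  have dim: "dim_vec \<alpha> = n + 1" using assms(1) by simp
  have deg: "char_deg1 n \<alpha> = c1" "char_deg2 n \<alpha> = c2"
    using c rank by (auto simp: char_deg1_def char_deg2_def)
  define R where "R m \<longleftrightarrow>
        (m \<le> c1 \<longrightarrow> hankel_kernel \<alpha> m = {0}) \<and>
        (c1 + 1 \<le> m \<and> m \<le> c2 \<longrightarrow> hankel_kernel \<alpha> m = {B1 * A1 | B1. degree B1 \<le> m - c1 - 1}) \<and>
        (c2 + 1 \<le> m \<and> m \<le> n + 1 \<longrightarrow> hankel_kernel \<alpha> m =
          {B1 * A1 + B2 * A2 | B1 B2. degree B1 \<le> m - c1 - 1 \<and> degree B2 \<le> m - c2 - 1})" for m
  have R: "R m \<longleftrightarrow> hankel_kernel \<alpha> m = graded_span A1 c1 A2 c2 m" if "m \<le> n + 1" for m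
  proof -
    consider "m \<le> c1" | "c1 < m" "m \<le> c2" | "c2 < m" by linarith
    then show ?thesis
    proof cases
      case 1
      then show ?thesis using c by (simp add: R_def graded_span_zero)
    next
      case 2
      then show ?thesis by (simp add: R_def graded_span_left degree_le_iff_polys_below[simplified])
    next
      case 3
      then show ?thesis using c that
        by (simp add: R_def graded_span_def degree_le_iff_polys_below[simplified])
    qed
  qed
  have "kernel_structure n \<alpha> A1 A2 \<longleftrightarrow> (\<forall>l m. l \<ge> 1 \<longrightarrow> m \<ge> 1 \<longrightarrow> l + m = n + 2 \<longrightarrow> R m)"
    unfolding kernel_structure_def Let_def deg R_def
    using hankel_kernel_eq[of _ _ \<alpha>] dim by (intro all_cong1 imp_cong refl) simp
  also have "\<dots> \<longleftrightarrow> (\<forall>m. 1 \<le> m \<and> m \<le> n + 1 \<longrightarrow> R m)"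
  proof (intro iffI allI impI)
    fix m assume *: "\<forall>l m. l \<ge> 1 \<longrightarrow> m \<ge> 1 \<longrightarrow> l + m = n + 2 \<longrightarrow> R m" and "1 \<le> m \<and> m \<le> n + 1"
    then show "R m" by (intro *[rule_format, of "n + 2 - m" m]) auto
  qed auto
  also have "\<dots> \<longleftrightarrow> (\<forall>m. m \<le> n + 1 \<longrightarrow> hankel_kernel \<alpha> m = graded_span A1 c1 A2 c2 m)"
  proof -
    have "hankel_kernel \<alpha> 0 = graded_span A1 c1 A2 c2 0"
      by (auto simp: hankel_kernel_def graded_span_zero)
    then show ?thesis using R by (metis less_one linorder_not_less)
  qed
  finally show ?thesis using c dim by (simp add: hankel_generators_def)
qed

text \<open>If \<open>c1 = 0\<close>, then \<open>A1\<close> is a constant, and every entry of \<open>\<alpha>\<close> is up to a unit the value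
  of the form at a shift of \<open>A1\<close>.\<close>

lemma zero_vec_iff_generators:
  fixes \<alpha> :: "'a::field vec"
  assumes gen: "hankel_generators \<alpha> A1 c1 A2 c2" and "\<alpha> \<in> carrier_vec (n + 1)"
    and "c1 \<le> c2" "A1 \<noteq> 0" "degree A1 \<le> c1"
  shows "\<alpha> = 0\<^sub>v (n + 1) \<longleftrightarrow> c1 = 0"
proof
  have dim: "dim_vec \<alpha> = n + 1" using assms(2) by simp
  have c: "c1 + c2 = n + 2" using gen dim by (simp add: hankel_generators_def)
  have K1: "hankel_kernel \<alpha> 1 = graded_span A1 c1 A2 c2 1"
    using hankel_generators_kernelD[OF gen] dim by simp
  {
    assume "\<alpha> = 0\<^sub>v (n + 1)"
    then have "hankel_form \<alpha> p = 0" for p by (simp add: hankel_form_def)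
    then have "1 \<in> hankel_kernel \<alpha> 1" by (simp add: hankel_kernel_def polys_below_iff)
    then show "c1 = 0"
      using graded_span_zero[of 1 c1 c2 A1 A2] \<open>c1 \<le> c2\<close> K1 by (cases "c1 = 0") auto
  next
    assume "c1 = 0"
    then obtain x where x: "A1 = [:x:]" "x \<noteq> 0"
      using assms(4,5) by (metis degree_eq_zeroE le_zero_eq pCons_0_0)
    show "\<alpha> = 0\<^sub>v (n + 1)"
    proof (intro eq_vecI)
      fix i assume "i < dim_vec (0\<^sub>v (n + 1) :: 'a vec)"
      then have i: "i < n + 1" by simp
      then have "hankel_form \<alpha> (monom 1 i * A1) = 0"
        using hankel_form_left_generator[OF gen] c \<open>c1 = 0\<close> by simp
      also have "monom 1 i * A1 = Polynomial.smult x (monom 1 i)" using x by simp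
      finally show "\<alpha> $ i = 0\<^sub>v (n + 1) $ i"
        using x i dim by (simp add: hankel_form_smult hankel_form_monom)
    qed (simp add: dim)
  }
qed

text \<open>The conventions for the zero sequence and for the class of rank and \<open>\<rho>\<close> equal to one
  follow from monicity, coprimality and \<open>deg A2 < deg A1\<close>. The convention for rank one and
  \<open>\<rho> = 0\<close> does not, and is therefore a hypothesis.\<close>

lemma char_polys_of_generators:
  fixes \<alpha> :: "'a::{field,finite} vec"
  assumes gen: "hankel_generators \<alpha> A1 c1 A2 c2" and carrier: "\<alpha> \<in> carrier_vec (n + 1)" and "n \<ge> 1"
    and c: "c1 \<le> c2" and cop: "coprime A1 A2"
    and monic: "lead_coeff A1 = 1" "A2 \<noteq> 0 \<Longrightarrow> lead_coeff A2 = 1"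
    and deg: "degree A1 \<le> c1" "degree A2 \<le> c2"
    and less: "degree A1 = c1 \<Longrightarrow> degree_less A2 A1" and eq: "c1 = c2 \<Longrightarrow> degree A1 = c1"
    and one: "c1 = 1 \<Longrightarrow> degree A1 = 0 \<Longrightarrow> A2 = monom 1 (n + 1)"
  shows "\<alpha> \<in> hankel_class n c1 (degree A1) (c1 - degree A1)"
    and "char_deg1 n \<alpha> = c1" and "char_deg2 n \<alpha> = c2" and "char_polys n \<alpha> A1 A2"
proof -
  have A1: "A1 \<noteq> 0" using monic(1) by auto
  have rank: "hankel_rank n \<alpha> = c1"
    by (rule hankel_rank_of_generators[OF gen carrier \<open>n \<ge> 1\<close> c A1])
  have rho: "hankel_rho n \<alpha> = degree A1"
    by (rule hankel_rho_of_generators[OF gen carrier \<open>n \<ge> 1\<close> c A1 deg(1) eq])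
  have sum: "c1 + c2 = n + 2" using gen carrier by (simp add: hankel_generators_def)
  show "char_deg1 n \<alpha> = c1" and deg2: "char_deg2 n \<alpha> = c2"
    using rank sum by (auto simp: char_deg1_def char_deg2_def)
  show "\<alpha> \<in> hankel_class n c1 (degree A1) (c1 - degree A1)"
    using rank rho carrier by (simp add: hankel_class_def hankel_pi_def)
  have const: "A1 = 1" if "degree A1 = 0"
    using that monic(1) by (metis degree_eq_zeroE lead_coeff_pCons(2) one_pCons)
  have "A1 = 1 \<and> A2 = 0" if "\<alpha> = 0\<^sub>v (n + 1)"
  proof -
    have "c1 = 0" using that zero_vec_iff_generators[OF gen carrier c A1 deg(1)] by simp
    then show ?thesis using const less deg(1) by (simp add: degree_less_def)
  qed
  moreover have "A2 = 1" if "\<alpha> \<in> hankel_class n 1 1 0"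
  proof -
    have d: "c1 = 1" "degree A1 = 1" using that rank rho by (simp_all add: hankel_class_def)
    then have less1: "A2 = 0 \<or> degree A2 = 0" using less by (simp add: degree_less_def)
    moreover have "A2 \<noteq> 0"
    proof
      assume "A2 = 0"
      then have "is_unit A1" using cop by simp
      then show False using d by (simp add: is_unit_iff_degree A1)
    qed
    ultimately show ?thesis
      using monic(2) by (metis degree_eq_zeroE lead_coeff_pCons(2) one_pCons)
  qed
  moreover have "A2 = monom 1 (n + 1)" if "\<alpha> \<in> hankel_class n 1 0 1"
    using that rank rho one by (simp add: hankel_class_def)
  moreover have "degree_less A2 A1" if "hankel_pi n \<alpha> = 0"
    using that less deg(1) by (simp add: hankel_pi_def rank rho)
  ultimately show "char_polys n \<alpha> A1 A2"
    using cop A1 rho deg deg2 monic gen kernel_structure_iff_generators[OF carrier rank sum c]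
    by (simp add: char_polys_def)
qed

text \<open>The discrepancy of a generator is an affine function of the new entry, with the
  coefficient of \<open>A1\<close> at its degree bound as slope.\<close>

lemma hankel_form_extend_generator:
  fixes \<alpha> :: "'a::field vec"
  assumes gen: "hankel_generators \<alpha> A1 c1 A2 c2" and "degree A1 \<le> c1" and "i < c2"
  shows "hankel_form (extend_seq \<alpha> a) (monom 1 i * A1) =
    (if Suc i = c2 then hankel_form \<alpha> (monom 1 (c2 - 1) * A1) + coeff A1 c1 * a else 0)"
proof -
  have "c1 + c2 = dim_vec \<alpha> + 1" using gen by (simp add: hankel_generators_def)
  then have "dim_vec \<alpha> = i + c1" if "Suc i = c2" using that by simp
  with \<open>c1 + c2 = dim_vec \<alpha> + 1\<close> have "coeff (monom 1 i * A1) (dim_vec \<alpha>) = (if Suc i = c2 then coeff A1 c1 else 0)"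
    using assms(2,3) by (cases "Suc i = c2") (auto simp: coeff_monom_mult coeff_eq_0)
  then show ?thesis
    using hankel_form_left_generator[OF gen, of i] \<open>i < c2\<close> by (auto simp: hankel_form_extend)
qed

text \<open>Otherwise \<open>A1\<close> would be a nonzero element of the kernel with \<open>c1\<close> columns, which is
  trivial.\<close>

lemma left_discrepancy_nonzero:
  fixes \<alpha> :: "'a::field vec"
  assumes gen: "hankel_generators \<alpha> A1 c1 A2 c2" and c: "c1 \<le> c2" "c1 \<le> dim_vec \<alpha>"
    and A1: "A1 \<noteq> 0" "degree A1 < c1"
  shows "hankel_form \<alpha> (monom 1 (c2 - 1) * A1) \<noteq> 0"
proof
  assume zero: "hankel_form \<alpha> (monom 1 (c2 - 1) * A1) = 0"
  have sum: "c1 + c2 = dim_vec \<alpha> + 1" using gen by (simp add: hankel_generators_def)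
  have "hankel_form \<alpha> (monom 1 i * A1) = 0" if "i + c1 \<le> dim_vec \<alpha>" for i
  proof (cases "Suc i = c2")
    case True
    then show ?thesis using zero by auto
  next
    case False
    then show ?thesis using hankel_form_left_generator[OF gen, of i] that sum by simp
  qed
  then have "A1 \<in> hankel_kernel \<alpha> c1"
    using A1 by (simp add: hankel_kernel_def polys_below_iff)
  then show False
    using A1(1) hankel_generators_kernelD[OF gen c(2)] graded_span_zero[of c1 c1 c2 A1 A2] c(1) by simp
qed

text \<open>Otherwise \<open>A2\<close> would lie in the kernel with \<open>c2\<close> columns, whose elements are multiples
  of \<open>A1\<close>, against coprimality.\<close>

lemma right_discrepancy_nonzero:
  fixes \<alpha> :: "'a::field vec"
  assumes gen: "hankel_generators \<alpha> A1 c1 A2 c2" and c: "c1 \<le> c2" "1 \<le> c1"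
    and A1: "degree A1 = c1" and less: "degree_less A2 A1" and cop: "coprime A1 A2"
  shows "hankel_form \<alpha> (monom 1 (c1 - 1) * A2) \<noteq> 0"
proof
  assume zero: "hankel_form \<alpha> (monom 1 (c1 - 1) * A2) = 0"
  have sum: "c1 + c2 = dim_vec \<alpha> + 1" using gen by (simp add: hankel_generators_def)
  have gen': "hankel_generators \<alpha> A2 c2 A1 c1" using gen by (simp add: hankel_generators_commute)
  have "hankel_form \<alpha> (monom 1 i * A2) = 0" if "i + c2 \<le> dim_vec \<alpha>" for i
  proof (cases "Suc i = c1")
    case True
    then show ?thesis using zero by auto
  next
    case False
    then show ?thesis using hankel_form_left_generator[OF gen', of i] that sum by simp
  qed
  moreover have "A2 \<in> polys_below c2"
    using less A1 c by (auto simp: degree_less_def polys_below_iff)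
  ultimately have "A2 \<in> hankel_kernel \<alpha> c2" by (simp add: hankel_kernel_def)
  then have "A2 \<in> graded_span A1 c1 A2 c2 c2"
    using hankel_generators_kernelD[OF gen, of c2] sum c by simp
  then have "A1 dvd A2" by (auto simp: graded_span_left)
  then have "is_unit A1" using cop by (metis coprime_common_divisor dvd_refl)
  then show False using A1 c less by (simp add: is_unit_iff_degree degree_less_def)
qed

text \<open>Suppose both generators fall short of their degree bounds. Then every polynomial of
  degree at most \<open>n\<close> annihilated by the form has degree below \<open>n\<close>, which forces all entries
  of \<open>\<alpha>\<close> but the last to vanish. But then the constant \<open>1\<close> lies in the kernel with two
  columns, which is trivial for \<open>c1 \<ge> 2\<close>.\<close>

lemma degree_right_generator:
  fixes \<alpha> :: "'a::field vec"
  assumes gen: "hankel_generators \<alpha> A1 c1 A2 c2" and c: "c1 \<le> c2" "2 \<le> c1"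
    and A1: "degree A1 < c1" and A2: "degree A2 \<le> c2"
  shows "degree A2 = c2"
proof (rule ccontr)
  assume "degree A2 \<noteq> c2"
  then have A2': "degree A2 \<le> c2 - 1" using A2 by simp
  define n where "n = dim_vec \<alpha> - 1"
  have sum: "c1 + c2 = n + 2" and dim: "dim_vec \<alpha> = n + 1"
    using gen c by (auto simp: hankel_generators_def n_def)
  have K: "hankel_kernel \<alpha> (n + 1) \<subseteq> polys_below n"
  proof
    fix p assume "p \<in> hankel_kernel \<alpha> (n + 1)"
    then obtain B1 B2 where p: "p = B1 * A1 + B2 * A2"
      and B: "B1 \<in> polys_below (n + 1 - c1)" "B2 \<in> polys_below (n + 1 - c2)"
      using hankel_generators_kernelD[OF gen, of "n + 1"] dim by (auto simp: graded_span_def)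
    have "A1 * B1 \<in> polys_below ((c1 - 1) + (n + 1 - c1))"
      using A1 by (intro polys_below_mult B) (auto simp: polys_below_iff)
    moreover have "A2 * B2 \<in> polys_below ((c2 - 1) + (n + 1 - c2))"
      using A2' by (intro polys_below_mult B) (auto simp: polys_below_iff)
    ultimately show "p \<in> polys_below n"
      unfolding p using sum c by (intro polys_below_add) (simp_all add: mult.commute)
  qed
  have zero: "\<alpha> $ i = 0" if "i < n" for i
  proof -
    \<comment> \<open>The form vanishes at \<open>\<alpha>_n T^i - \<alpha>_i T^n\<close>, whose coefficient at \<open>T^n\<close> must therefore be zero.\<close>
    define p where "p = Polynomial.smult (\<alpha> $ n) (monom 1 i) - Polynomial.smult (\<alpha> $ i) (monom 1 n)"
    have "hankel_form \<alpha> p = 0"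
      using that dim by (simp add: p_def hankel_form_diff hankel_form_smult hankel_form_monom)
    moreover have "p \<in> polys_below (n + 1)"
      using that by (auto simp: p_def polys_below_def)
    ultimately have "p \<in> hankel_kernel \<alpha> (n + 1)"
      by (auto simp: hankel_kernel_def dim)
    then have "coeff p n = 0" using K by (auto simp: polys_below_def)
    then show ?thesis using that by (simp add: p_def)
  qed
  then have "1 \<in> hankel_kernel \<alpha> 2"
    using dim by (auto simp: hankel_kernel_def polys_below_iff hankel_form_monom)
  then show False
    using hankel_generators_kernelD[OF gen, of 2] graded_span_zero[of 2 c1 c2 A1 A2] c sum dim by auto
qed

section \<open>Dependence of the extended generators on the new entry\<close>

lemma coprime_smult_add_mult:
  fixes A1 A2 :: "'a::field poly"
  assumes "coprime A1 A2" "c \<noteq> 0"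
  shows "coprime A1 (Polynomial.smult c A2 + M * A1)"
proof (rule coprimeI)
  fix d assume d: "d dvd A1" "d dvd Polynomial.smult c A2 + M * A1"
  then have "d dvd Polynomial.smult c A2" by (simp add: dvd_add_left_iff)
  then have "d dvd A2" using assms(2) by (simp add: dvd_smult_iff)
  then show "is_unit d" using d(1) assms(1) by (metis coprime_common_divisor)
qed

lemma monic_add_lower_degree:
  fixes p q :: "'a::field poly"
  assumes "lead_coeff q = 1" "degree p < degree q"
  shows "lead_coeff (p + q) = 1" "degree (p + q) = degree q"
  using assms by (simp_all add: degree_add_eq_right coeff_eq_0)

lemma degree_monom_mult_monic:
  fixes p :: "'a::field poly"
  assumes "lead_coeff p = 1"
  shows "degree (monom 1 k * p) = k + degree p" "lead_coeff (monom 1 k * p) = 1"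
proof -
  have "p \<noteq> 0" using assms by auto
  then show deg: "degree (monom 1 k * p) = k + degree p"
    by (simp add: degree_mult_eq Polynomial.degree_monom_eq monom_eq_0_iff)
  show "lead_coeff (monom 1 k * p) = 1"
    unfolding deg using assms by (simp add: coeff_monom_mult)
qed

lemma bij_affine:
  fixes m b :: "'a::field"
  assumes "m \<noteq> 0"
  shows "bij (\<lambda>a. m * a + b)"
  by (rule o_bij[of "\<lambda>y. (y - b) / m"]) (use assms in \<open>auto simp: fun_eq_iff field_simps\<close>)

lemma generators_of_char_polys:
  fixes \<alpha> :: "'a::field vec"
  assumes "char_polys n \<alpha> A1 A2" and cls: "\<alpha> \<in> hankel_class n r \<rho> \<pi>" and "r \<le> n1 n"
  shows "hankel_generators \<alpha> A1 r A2 (n + 2 - r)"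
    and "char_deg1 n \<alpha> = r" "char_deg2 n \<alpha> = n + 2 - r" "degree A1 = \<rho>" "\<pi> = r - \<rho>"
    and "coprime A1 A2" "lead_coeff A1 = 1" "A2 \<noteq> 0 \<longrightarrow> lead_coeff A2 = 1" "degree A2 \<le> n + 2 - r"
proof -
  have "r + (n + 2 - r) = n + 2" "r \<le> n + 2 - r" using \<open>r \<le> n1 n\<close> by (auto simp: n1_def)
  then show "hankel_generators \<alpha> A1 r A2 (n + 2 - r)"
    using kernel_structure_iff_generators[of \<alpha> n r "n + 2 - r" A1 A2] assms
    by (simp add: char_polys_def hankel_class_def)
qed (use assms in \<open>auto simp: char_polys_def hankel_class_def hankel_pi_def char_deg1_def char_deg2_def\<close>)

text \<open>The slopes of the two discrepancies are the coefficient \<open>1\<close> of \<open>T^c1\<close> in \<open>A1\<close> and the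
  coefficient \<open>0\<close> of \<open>T^c2\<close> in \<open>A2\<close>.\<close>

lemma nonsingular_discrepancies:
  fixes \<alpha> :: "'a::field vec"
  assumes gen: "hankel_generators \<alpha> A1 c1 A2 c2" and c: "c1 \<le> c2"
    and cop: "coprime A1 A2" and A1: "degree A1 = c1" "lead_coeff A1 = 1"
    and less: "degree_less A2 A1"
  obtains k d where "d \<noteq> 0"
    and "\<And>a i. i < c2 \<Longrightarrow> hankel_form (extend_seq \<alpha> a) (monom 1 i * A1) = (if Suc i = c2 then k + a else 0)"
    and "\<And>a i. i < c1 \<Longrightarrow> hankel_form (extend_seq \<alpha> a) (monom 1 i * A2) = (if Suc i = c1 then d else 0)"
proof (rule that)
  \<comment> \<open>For \<open>c1 = 0\<close> there is no shift to evaluate; any nonzero value serves, since \<open>A2 = 0\<close>.\<close>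
  let ?d = "if c1 = 0 then 1 else hankel_form \<alpha> (monom 1 (c1 - 1) * A2)"
  have gen': "hankel_generators \<alpha> A2 c2 A1 c1" using gen by (simp add: hankel_generators_commute)
  show "?d \<noteq> 0"
    using right_discrepancy_nonzero[OF gen c _ A1(1) less cop] by simp
  show "hankel_form (extend_seq \<alpha> a) (monom 1 i * A1) =
      (if Suc i = c2 then hankel_form \<alpha> (monom 1 (c2 - 1) * A1) + a else 0)" if "i < c2" for a i
    using hankel_form_extend_generator[OF gen, of i a] that A1 by simp
  have A2: "degree A2 \<le> c2" "coeff A2 c2 = 0"
    using less A1(1) c by (auto simp: degree_less_def coeff_eq_0)
  show "hankel_form (extend_seq \<alpha> a) (monom 1 i * A2) = (if Suc i = c1 then ?d else 0)" if "i < c1" for a i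
    using hankel_form_extend_generator[OF gen' A2(1) that, of a] A2(2) that by simp
qed

text \<open>With \<open>\<beta> a = -\<delta>1 / \<delta>2\<close> the combination \<open>\<beta> A2 + T^(c2-c1) A1\<close> has discrepancy \<open>0\<close>, and
  the regular case \<open>\<delta>1 = 0\<close> is the zero of \<open>\<beta>\<close>.\<close>

lemma extend_nonsingular:
  fixes \<alpha> :: "'a::field vec"
  assumes gen: "hankel_generators \<alpha> A1 c1 A2 c2" and c: "c1 < c2"
    and cop: "coprime A1 A2" and A1: "degree A1 = c1" "lead_coeff A1 = 1"
    and less: "degree_less A2 A1"
  obtains \<beta> where "bij \<beta>"
    and "\<And>a. \<beta> a = 0 \<Longrightarrow> hankel_generators (extend_seq \<alpha> a) A1 c1 A2 (c2 + 1)"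
    and "\<And>a. \<beta> a \<noteq> 0 \<Longrightarrow> hankel_generators (extend_seq \<alpha> a) A1 (c1 + 1)
           (Polynomial.smult (\<beta> a) A2 + monom 1 (c2 - c1) * A1) c2"
proof -
  obtain k d where d: "d \<noteq> 0"
    and \<delta>: "\<And>a i. i < c2 \<Longrightarrow> hankel_form (extend_seq \<alpha> a) (monom 1 i * A1) = (if Suc i = c2 then k + a else 0)"
      "\<And>a i. i < c1 \<Longrightarrow> hankel_form (extend_seq \<alpha> a) (monom 1 i * A2) = (if Suc i = c1 then d else 0)"
    by (rule nonsingular_discrepancies[OF gen less_imp_le[OF c] cop A1 less]) (rule that)
  have deg: "degree A1 \<le> c1" "degree A2 \<le> c2" using A1 less c by (auto simp: degree_less_def)
  have "A1 \<noteq> 0" using less by (simp add: degree_less_def)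
  note full = polys_below_subset_graded_span[OF cop this A1(1) deg(2)]
  define \<beta> where "\<beta> a = (- 1 / d) * a + (- k / d)" for a
  have \<beta>: "\<beta> a * d + 1 * (k + a) = 0" for a using d by (simp add: \<beta>_def field_simps)
  show thesis
  proof (rule that)
    show "bij \<beta>" unfolding \<beta>_def using d by (intro bij_affine) simp
    show "hankel_generators (extend_seq \<alpha> a) A1 c1 A2 (c2 + 1)" if "\<beta> a = 0" for a
      using that \<beta>[of a] by (intro generators_extend_regular[OF gen full deg _ \<delta>(2) d]) (auto simp: \<delta>(1))
    show "hankel_generators (extend_seq \<alpha> a) A1 (c1 + 1)
        (Polynomial.smult (\<beta> a) A2 + monom 1 (c2 - c1) * A1) c2" if "\<beta> a \<noteq> 0" for a
    proof -
      have "k + a \<noteq> 0" using \<beta>[of a] that d by auto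
      from generators_extend_jump[OF gen _ full deg \<delta> this that \<beta>] c show ?thesis by simp
    qed
  qed
qed

text \<open>Since both degree bounds agree and \<open>\<delta>2\<close> is never zero, \<open>A2\<close> can always take the role
  of the generator that is kept, and \<open>A1\<close> is corrected.\<close>

lemma extend_nonsingular_balanced:
  fixes \<alpha> :: "'a::field vec"
  assumes gen: "hankel_generators \<alpha> A1 c A2 c"
    and cop: "coprime A1 A2" and A1: "degree A1 = c" "lead_coeff A1 = 1"
    and less: "degree_less A2 A1"
  obtains \<beta> where "bij \<beta>"
    and "\<And>a. hankel_generators (extend_seq \<alpha> a) (Polynomial.smult (\<beta> a) A2 + A1) c A2 (c + 1)"
proof -
  obtain k d where d: "d \<noteq> 0"
    and \<delta>: "\<And>a i. i < c \<Longrightarrow> hankel_form (extend_seq \<alpha> a) (monom 1 i * A1) = (if Suc i = c then k + a else 0)"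
      "\<And>a i. i < c \<Longrightarrow> hankel_form (extend_seq \<alpha> a) (monom 1 i * A2) = (if Suc i = c then d else 0)"
    by (rule nonsingular_discrepancies[OF gen le_refl cop A1 less]) (rule that)
  have deg: "degree A1 \<le> c" "degree A2 \<le> c" using A1 less by (auto simp: degree_less_def)
  have "A1 \<noteq> 0" using less by (simp add: degree_less_def)
  then have full: "polys_below (c + c) \<subseteq> graded_span A2 c A1 c (c + c)"
    using polys_below_subset_graded_span[OF cop _ A1(1) deg(2)] graded_span_commute[of A1] by simp
  have gen': "hankel_generators \<alpha> A2 c A1 c" using gen by (simp add: hankel_generators_commute)
  define \<beta> where "\<beta> a = (- 1 / d) * a + (- k / d)" for a
  have \<beta>: "1 * (k + a) + \<beta> a * d = 0" for a using d by (simp add: \<beta>_def field_simps)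
  show thesis
  proof (rule that)
    show "bij \<beta>" unfolding \<beta>_def using d by (intro bij_affine) simp
    show "hankel_generators (extend_seq \<alpha> a) (Polynomial.smult (\<beta> a) A2 + A1) c A2 (c + 1)" for a
      using generators_extend_jump[OF gen' _ full deg(2,1) \<delta>(2,1) d _ \<beta>]
      by (simp add: add.commute monom_eq_1 hankel_generators_commute[of _ _ c])
  qed
qed

text \<open>The discrepancy of \<open>A1\<close> is now a nonzero constant, and that of the monic \<open>A2\<close> has
  slope \<open>1\<close>; so \<open>\<beta> a = -\<delta>2 / \<delta>1\<close>.\<close>

lemma extend_singular:
  fixes \<alpha> :: "'a::field vec"
  assumes gen: "hankel_generators \<alpha> A1 c1 A2 c2" and c: "c1 \<le> c2" "c1 \<le> dim_vec \<alpha>"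
    and cop: "coprime A1 A2" and A1: "A1 \<noteq> 0" "degree A1 < c1"
    and A2: "degree A2 = c2" "lead_coeff A2 = 1"
  obtains \<beta> where "bij \<beta>"
    and "\<And>a. hankel_generators (extend_seq \<alpha> a) A1 (c1 + 1)
           (Polynomial.smult (\<beta> a) (monom 1 (c2 - c1) * A1) + A2) c2"
proof -
  define d where "d = hankel_form \<alpha> (monom 1 (c2 - 1) * A1)"
  define k where "k = hankel_form \<alpha> (monom 1 (c1 - 1) * A2)"
  have d: "d \<noteq> 0" unfolding d_def by (rule left_discrepancy_nonzero[OF gen c A1])
  have gen': "hankel_generators \<alpha> A2 c2 A1 c1" using gen by (simp add: hankel_generators_commute)
  have deg: "degree A1 \<le> c1" "degree A2 \<le> c2" using A1 A2 by auto
  have "A2 \<noteq> 0" using A2(2) by auto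
  then have full: "polys_below (c1 + c2) \<subseteq> graded_span A1 c1 A2 c2 (c1 + c2)"
    using polys_below_subset_graded_span[of A2 A1 c2 c1] cop A2(1) deg(1)
    by (simp add: coprime_commute add.commute graded_span_commute[of A2])
  have \<delta>1: "hankel_form (extend_seq \<alpha> a) (monom 1 i * A1) = (if Suc i = c2 then d else 0)" if "i < c2" for a i
    using hankel_form_extend_generator[OF gen deg(1) that, of a] A1(2) by (simp add: d_def coeff_eq_0)
  have \<delta>2: "hankel_form (extend_seq \<alpha> a) (monom 1 i * A2) = (if Suc i = c1 then k + a else 0)" if "i < c1" for a i
    using hankel_form_extend_generator[OF gen' deg(2) that, of a] A2 by (simp add: k_def)
  define \<beta> where "\<beta> a = (- 1 / d) * a + (- k / d)" for a
  have \<beta>: "1 * (k + a) + \<beta> a * d = 0" for a using d by (simp add: \<beta>_def field_simps)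
  show thesis
  proof (rule that)
    show "bij \<beta>" unfolding \<beta>_def using d by (intro bij_affine) simp
    show "hankel_generators (extend_seq \<alpha> a) A1 (c1 + 1)
           (Polynomial.smult (\<beta> a) (monom 1 (c2 - c1) * A1) + A2) c2" for a
      using generators_extend_jump[OF gen c(1) full deg \<delta>1 \<delta>2 d _ \<beta>] by (simp add: add.commute)
  qed
qed

lemma extend_seq_carrier: "\<alpha> \<in> carrier_vec (n + 1) \<Longrightarrow> extend_seq \<alpha> a \<in> carrier_vec (n + 1 + 1)"
  by (intro carrier_vecI) auto

lemma bij_zero_set:
  fixes \<beta> :: "'a \<Rightarrow> 'b::zero"
  assumes "bij \<beta>"
  shows "\<exists>!a. \<beta> a = 0" "bij_betw \<beta> {a. \<beta> a \<noteq> 0} (UNIV - {0})"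
proof -
  show "\<exists>!a. \<beta> a = 0" using assms by (metis bij_pointE)
  have "{a. \<beta> a \<noteq> 0} = \<beta> -` (UNIV - {0})" by auto
  then show "bij_betw \<beta> {a. \<beta> a \<noteq> 0} (UNIV - {0})"
    using assms by (auto simp: bij_betw_def inj_on_def surj_def image_iff)
qed

lemma nonsingular_class_data:
  fixes \<alpha> :: "'a::field vec"
  assumes "char_polys n \<alpha> A1 A2" "\<alpha> \<in> hankel_class n r r 0" "r \<le> n1 n"
  shows "hankel_generators \<alpha> A1 r A2 (n + 2 - r)" "coprime A1 A2" "lead_coeff A1 = 1"
    and "A2 \<noteq> 0 \<longrightarrow> lead_coeff A2 = 1" "degree A1 = r" "degree_less A2 A1"
proof -
  note d = generators_of_char_polys[OF assms]
  show "hankel_generators \<alpha> A1 r A2 (n + 2 - r)" by (rule d(1))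
  show "coprime A1 A2" by (rule d(6))
  show "lead_coeff A1 = 1" by (rule d(7))
  show "A2 \<noteq> 0 \<longrightarrow> lead_coeff A2 = 1" by (rule d(8))
  show "degree A1 = r" by (rule d(4))
  show "degree_less A2 A1" using assms(1,2) by (simp add: char_polys_def hankel_class_def)
qed

text \<open>For rank one the degree of \<open>A2\<close> comes from the convention \<open>A2 = T^(n+1)\<close>, since no
  kernel involves \<open>A2\<close>.\<close>

lemma singular_class_data:
  fixes \<alpha> :: "'a::field vec"
  assumes ch: "char_polys n \<alpha> A1 A2" and cls: "\<alpha> \<in> hankel_class n r \<rho> \<pi>" and r: "r \<le> n1 n"
    and "\<pi> \<ge> 1"
  shows "\<rho> < r" "r = \<rho> + \<pi>" "degree A2 = n + 2 - r" "lead_coeff A2 = 1"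
proof -
  note d = generators_of_char_polys[OF ch cls r]
  show \<rho>: "\<rho> < r" "r = \<rho> + \<pi>" using d(5) \<open>\<pi> \<ge> 1\<close> by auto
  show deg: "degree A2 = n + 2 - r"
  proof (cases "r = 1")
    case True
    then have "\<alpha> \<in> hankel_class n 1 0 1" using cls \<rho> by simp
    then have "A2 = monom 1 (n + 1)" using ch by (simp add: char_polys_def)
    then show ?thesis using True Polynomial.degree_monom_eq[of "1 :: 'a" "n + 1"] by simp
  next
    case False
    have "r \<le> n + 2 - r" using r by (auto simp: n1_def)
    then show ?thesis
      using degree_right_generator[OF d(1)] False d(4,9) \<rho> by simp
  qed
  have "n + 2 - r > 0" using r by (auto simp: n1_def)
  then have "A2 \<noteq> 0" using deg by auto
  then show "lead_coeff A2 = 1" using d(8) by simp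
qed

lemma regular_extension:
  fixes \<alpha> :: "'a::{field,finite} vec"
  assumes ch: "char_polys n \<alpha> A1 A2" and cls: "\<alpha> \<in> hankel_class n r r 0" and "n \<ge> 1" "2 * r < n + 2"
    and gen: "hankel_generators (extend_seq \<alpha> a) A1 r A2 (n + 3 - r)"
  shows "extend_seq \<alpha> a \<in> hankel_class (n + 1) r r 0"
    and "char_deg1 (n + 1) (extend_seq \<alpha> a) = r" "char_deg2 (n + 1) (extend_seq \<alpha> a) = n + 3 - r"
    and "char_polys (n + 1) (extend_seq \<alpha> a) A1 A2"
proof -
  have "r \<le> n1 n" using \<open>2 * r < n + 2\<close> by (auto simp: n1_def)
  note d = nonsingular_class_data[OF ch cls this]
  have car: "extend_seq \<alpha> a \<in> carrier_vec (n + 1 + 1)"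
    using cls by (intro extend_seq_carrier) (simp add: hankel_class_def)
  have side: "1 \<le> n + 1" "r \<le> n + 3 - r" "A2 \<noteq> 0 \<Longrightarrow> lead_coeff A2 = 1" "degree A1 \<le> r"
    "degree A2 \<le> n + 3 - r" "degree A1 = r \<Longrightarrow> degree_less A2 A1" "r = n + 3 - r \<Longrightarrow> degree A1 = r"
    "r = 1 \<Longrightarrow> degree A1 = 0 \<Longrightarrow> A2 = monom 1 (n + 1 + 1)"
    using d \<open>2 * r < n + 2\<close> by (auto simp: degree_less_def)
  note * = char_polys_of_generators[OF gen car side(1,2) d(2,3) side(3-8)]
  show "extend_seq \<alpha> a \<in> hankel_class (n + 1) r r 0" using *(1) d(5) by simp
  show "char_deg1 (n + 1) (extend_seq \<alpha> a) = r" by (rule *(2))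
  show "char_deg2 (n + 1) (extend_seq \<alpha> a) = n + 3 - r" by (rule *(3))
  show "char_polys (n + 1) (extend_seq \<alpha> a) A1 A2" by (rule *(4))
qed

lemma nonsingular_jump_generator:
  fixes A1 A2 :: "'a::field poly"
  assumes cop: "coprime A1 A2" and A1: "lead_coeff A1 = 1" "degree A1 = c1" and c: "c1 < c2"
    and less: "degree_less A2 A1" and "b \<noteq> 0"
  defines "A2' \<equiv> Polynomial.smult b A2 + monom 1 (c2 - c1) * A1"
  shows "coprime A1 A2'" "lead_coeff A2' = 1" "degree A2' = c2"
proof -
  show "coprime A1 A2'" unfolding A2'_def by (rule coprime_smult_add_mult[OF cop \<open>b \<noteq> 0\<close>])
  have q: "degree (monom 1 (c2 - c1) * A1) = c2" "lead_coeff (monom 1 (c2 - c1) * A1) = 1"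
    using degree_monom_mult_monic[OF A1(1), of "c2 - c1"] A1(2) c by simp_all
  have "degree (Polynomial.smult b A2) < c2" using less A1(2) c by (auto simp: degree_less_def)
  then show "lead_coeff A2' = 1" "degree A2' = c2"
    using monic_add_lower_degree[OF q(2), of "Polynomial.smult b A2"] q(1) by (simp_all add: A2'_def)
qed

lemma singular_jump_generator:
  fixes A1 A2 :: "'a::field poly" and b :: 'a
  assumes cop: "coprime A1 A2" and A1: "lead_coeff A1 = 1" "degree A1 < c1" and c: "c1 \<le> c2"
    and A2: "lead_coeff A2 = 1" "degree A2 = c2"
  defines "A2' \<equiv> Polynomial.smult b (monom 1 (c2 - c1) * A1) + A2"
  shows "coprime A1 A2'" "lead_coeff A2' = 1" "degree A2' = c2"
proof -
  have "A2' = Polynomial.smult 1 A2 + Polynomial.smult b (monom 1 (c2 - c1)) * A1"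
    by (simp add: A2'_def)
  then show "coprime A1 A2'" by (simp only: coprime_smult_add_mult[OF cop one_neq_zero])
  have "degree (Polynomial.smult b (monom 1 (c2 - c1) * A1)) < c2"
    using degree_monom_mult_monic[OF A1(1), of "c2 - c1"] A1(2) c degree_smult_le[of b "monom 1 (c2 - c1) * A1"]
    by simp
  then show "lead_coeff A2' = 1" "degree A2' = c2"
    using monic_add_lower_degree[OF A2(1), of "Polynomial.smult b (monom 1 (c2 - c1) * A1)"] A2(2)
    by (simp_all only: A2'_def)
qed

theorem theorem2p4p11:
  fixes n :: nat and \<alpha> :: "'a::{field,finite} vec" and A1 A2 :: "'a poly"
  assumes "n \<ge> 1"
    and "\<alpha> \<in> carrier_vec (n + 1)"
    and "char_polys n \<alpha> A1 A2"
  shows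
    "(\<forall>r. r \<le> n1 n - 1 \<and> \<alpha> \<in> hankel_class n r r 0 \<longrightarrow>
      char_deg1 n \<alpha> = r \<and> char_deg2 n \<alpha> = n + 2 - r \<and> degree A1 = r \<and> degree_less A2 A1 \<and>
      (\<exists>!a. extend_seq \<alpha> a \<in> hankel_class (n + 1) r r 0) \<and>
      (\<forall>a. extend_seq \<alpha> a \<in> hankel_class (n + 1) r r 0 \<longrightarrow>
        char_deg1 (n + 1) (extend_seq \<alpha> a) = r \<and>
        char_deg2 (n + 1) (extend_seq \<alpha> a) = n + 3 - r \<and>
        char_polys (n + 1) (extend_seq \<alpha> a) A1 A2) \<and>
      card {a. extend_seq \<alpha> a \<in> hankel_class (n + 1) (r + 1) r 1} = card (UNIV :: 'a set) - 1 \<and>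
      (\<exists>\<beta>. bij_betw \<beta> {a. extend_seq \<alpha> a \<in> hankel_class (n + 1) (r + 1) r 1} (UNIV - {0}) \<and>
        (\<forall>a. extend_seq \<alpha> a \<in> hankel_class (n + 1) (r + 1) r 1 \<longrightarrow>
          char_deg1 (n + 1) (extend_seq \<alpha> a) = r + 1 \<and>
          char_deg2 (n + 1) (extend_seq \<alpha> a) = n + 2 - r \<and>
          char_polys (n + 1) (extend_seq \<alpha> a) A1
            (Polynomial.smult (\<beta> a) A2 + monom 1 (char_deg2 n \<alpha> - char_deg1 n \<alpha>) * A1)))) \<and>

     (\<forall>r \<rho>\<^sub>1 \<pi>\<^sub>1. \<pi>\<^sub>1 \<ge> 1 \<and> r \<le> n1 n - 1 \<and> \<alpha> \<in> hankel_class n r \<rho>\<^sub>1 \<pi>\<^sub>1 \<longrightarrow>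
      r = \<rho>\<^sub>1 + \<pi>\<^sub>1 \<and>
      char_deg1 n \<alpha> = r \<and> char_deg2 n \<alpha> = n + 2 - r \<and>
      degree A1 = \<rho>\<^sub>1 \<and> degree A2 = char_deg2 n \<alpha> \<and>
      (\<exists>\<beta>. bij_betw \<beta> UNIV UNIV \<and>
        (\<forall>a. extend_seq \<alpha> a \<in> hankel_class (n + 1) (r + 1) \<rho>\<^sub>1 (\<pi>\<^sub>1 + 1) \<and>
          char_deg1 (n + 1) (extend_seq \<alpha> a) = r + 1 \<and>
          char_deg2 (n + 1) (extend_seq \<alpha> a) = n + 2 - r \<and>
          char_polys (n + 1) (extend_seq \<alpha> a) A1
            (Polynomial.smult (\<beta> a) (monom 1 (char_deg2 n \<alpha> - char_deg1 n \<alpha>) * A1) + A2)))) \<and>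

     (even n \<and> \<alpha> \<in> hankel_class n (n1 n) (n1 n) 0 \<longrightarrow>
      char_deg1 n \<alpha> = n1 n \<and> char_deg2 n \<alpha> = n1 n \<and> degree A1 = n1 n \<and> degree_less A2 A1 \<and>
      (\<exists>\<beta>. bij_betw \<beta> UNIV UNIV \<and>
        (\<forall>a. extend_seq \<alpha> a \<in> hankel_class (n + 1) (n1 n) (n1 n) 0 \<and>
          char_deg1 (n + 1) (extend_seq \<alpha> a) = n1 n \<and>
          char_deg2 (n + 1) (extend_seq \<alpha> a) = n1 n + 1 \<and>
          char_polys (n + 1) (extend_seq \<alpha> a) (Polynomial.smult (\<beta> a) A2 + A1) A2))) \<and>

     (odd n \<and> \<alpha> \<in> hankel_class n (n1 n) (n1 n) 0 \<longrightarrow>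
      char_deg1 n \<alpha> = n1 n \<and> char_deg2 n \<alpha> = n1 n + 1 \<and> degree A1 = n1 n \<and> degree_less A2 A1 \<and>
      (\<exists>!a. extend_seq \<alpha> a \<in> hankel_class (n + 1) (n1 n) (n1 n) 0) \<and>
      (\<forall>a. extend_seq \<alpha> a \<in> hankel_class (n + 1) (n1 n) (n1 n) 0 \<longrightarrow>
        char_deg1 (n + 1) (extend_seq \<alpha> a) = n1 n \<and>
        char_deg2 (n + 1) (extend_seq \<alpha> a) = n1 n + 2 \<and>
        char_polys (n + 1) (extend_seq \<alpha> a) A1 A2) \<and>
      card {a. extend_seq \<alpha> a \<in> hankel_class (n + 1) (n1 n + 1) (n1 n + 1) 0} = card (UNIV :: 'a set) - 1 \<and>
      (\<exists>\<beta>. bij_betw \<beta> {a. extend_seq \<alpha> a \<in> hankel_class (n + 1) (n1 n + 1) (n1 n + 1) 0} (UNIV - {0}) \<and>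
        (\<forall>a. extend_seq \<alpha> a \<in> hankel_class (n + 1) (n1 n + 1) (n1 n + 1) 0 \<longrightarrow>
          char_deg1 (n + 1) (extend_seq \<alpha> a) = n1 n + 1 \<and>
          char_deg2 (n + 1) (extend_seq \<alpha> a) = n1 n + 1 \<and>
          char_polys (n + 1) (extend_seq \<alpha> a) (Polynomial.smult (\<beta> a) A2 + monom 1 1 * A1) A1))) \<and>

     (\<forall>\<rho>\<^sub>1 \<pi>\<^sub>1. odd n \<and> \<pi>\<^sub>1 \<ge> 1 \<and> \<rho>\<^sub>1 \<le> n1 n - 1 \<and> \<alpha> \<in> hankel_class n (n1 n) \<rho>\<^sub>1 \<pi>\<^sub>1 \<longrightarrow>
      char_deg1 n \<alpha> = n1 n \<and> char_deg2 n \<alpha> = n1 n + 1 \<and>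
      degree A1 = \<rho>\<^sub>1 \<and> degree A2 = n1 n + 1 \<and>
      (\<exists>\<beta>. bij_betw \<beta> UNIV UNIV \<and>
        (\<forall>a. extend_seq \<alpha> a \<in> hankel_class (n + 1) (n1 n + 1) (n1 n + 1) 0 \<and>
          char_deg1 (n + 1) (extend_seq \<alpha> a) = n1 n + 1 \<and>
          char_deg2 (n + 1) (extend_seq \<alpha> a) = n1 n + 1 \<and>
          char_polys (n + 1) (extend_seq \<alpha> a) (Polynomial.smult (\<beta> a) (monom 1 1 * A1) + A2) A1)))"
proof -
  note ch = assms(3) and car = assms(2)
  have n: "1 \<le> n + 1" by simp
  have car': "extend_seq \<alpha> a \<in> carrier_vec (n + 1 + 1)" for a by (rule extend_seq_carrier[OF car])
  have half: "n1 n \<ge> 1" "r \<le> n1 n - 1 \<Longrightarrow> r \<le> n1 n \<and> 2 * (r + 1) \<le> n + 2"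
    "odd n \<Longrightarrow> n + 1 = 2 * n1 n" "even n \<Longrightarrow> n + 2 = 2 * n1 n" for r by (auto simp: n1_def)
  have dim: "dim_vec \<alpha> = n + 1" using car by simp
  show ?thesis
  proof (intro conjI, goal_cases)
    case 1
    show ?case
    proof (intro allI impI, goal_cases)
      case (1 r)
      then have r: "r \<le> n1 n" "2 * (r + 1) \<le> n + 2" and cls: "\<alpha> \<in> hankel_class n r r 0"
        using half by auto
      note d = nonsingular_class_data[OF ch cls r(1)]
      have c: "r < n + 2 - r" "r + 1 < n + 2 - r" "2 * r < n + 2" using r by auto
      obtain \<beta> where \<beta>: "bij \<beta>"
        and reg: "\<And>a. \<beta> a = 0 \<Longrightarrow> hankel_generators (extend_seq \<alpha> a) A1 r A2 (n + 2 - r + 1)"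
        and jump: "\<And>a. \<beta> a \<noteq> 0 \<Longrightarrow> hankel_generators (extend_seq \<alpha> a) A1 (r + 1)
           (Polynomial.smult (\<beta> a) A2 + monom 1 (n + 2 - r - r) * A1) (n + 2 - r)"
        by (rule extend_nonsingular[OF d(1) c(1) d(2,5,3,6)]) (rule that)
      have "n + 2 - r + 1 = n + 3 - r" using r by simp
      note reg' = regular_extension[OF ch cls assms(1) c(3) reg[unfolded this]]
      have jump': "extend_seq \<alpha> a \<in> hankel_class (n + 1) (r + 1) r 1"
        "char_deg1 (n + 1) (extend_seq \<alpha> a) = r + 1" "char_deg2 (n + 1) (extend_seq \<alpha> a) = n + 2 - r"
        "char_polys (n + 1) (extend_seq \<alpha> a) A1
          (Polynomial.smult (\<beta> a) A2 + monom 1 (n + 2 - r - r) * A1)" if "\<beta> a \<noteq> 0" for a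
      proof -
        note g = nonsingular_jump_generator[OF d(2,3,5) c(1) d(6) that]
        \<comment> \<open>For \<open>r = 0\<close> one has \<open>A1 = 1\<close> and \<open>A2 = 0\<close>, so the new generator is the prescribed power of \<open>T\<close>.\<close>
        have one: "Polynomial.smult (\<beta> a) A2 + monom 1 (n + 2 - r - r) * A1 = monom 1 (n + 1 + 1)"
          if "r + 1 = 1" "degree A1 = 0"
        proof -
          have "A1 = 1" using that d(3) by (metis degree_eq_zeroE lead_coeff_pCons(2) one_pCons)
          then show ?thesis using that d(6) by (simp add: degree_less_def)
        qed
        have side: "r + 1 \<le> n + 2 - r" "degree A1 \<le> r + 1"
          "degree (Polynomial.smult (\<beta> a) A2 + monom 1 (n + 2 - r - r) * A1) \<le> n + 2 - r"
          using c d(5) g(3) by auto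
        note * = char_polys_of_generators[OF jump[OF that] car' n side(1) g(1) d(3) g(2) side(2,3) _ _ one]
        show "extend_seq \<alpha> a \<in> hankel_class (n + 1) (r + 1) r 1" using *(1) d(5) c(2) by simp
        show "char_deg1 (n + 1) (extend_seq \<alpha> a) = r + 1" "char_deg2 (n + 1) (extend_seq \<alpha> a) = n + 2 - r"
          "char_polys (n + 1) (extend_seq \<alpha> a) A1
          (Polynomial.smult (\<beta> a) A2 + monom 1 (n + 2 - r - r) * A1)" using *(2-4) d(5) c(2) by simp_all
      qed
      have iff: "extend_seq \<alpha> a \<in> hankel_class (n + 1) r r 0 \<longleftrightarrow> \<beta> a = 0"
        "extend_seq \<alpha> a \<in> hankel_class (n + 1) (r + 1) r 1 \<longleftrightarrow> \<beta> a \<noteq> 0" for a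
        using reg'(1)[of a] jump'(1)[of a] by (cases "\<beta> a = 0"; auto simp: hankel_class_def)+
      have deg: "char_deg1 n \<alpha> = r" "char_deg2 n \<alpha> = n + 2 - r"
        using generators_of_char_polys(2,3)[OF ch cls r(1)] .
      have card: "card {a. \<beta> a \<noteq> 0} = card (UNIV :: 'a set) - 1"
        using bij_betw_same_card[OF bij_zero_set(2)[OF \<beta>]] by (simp add: card_Diff_subset)
      show ?case
        unfolding iff deg
        by (intro conjI exI[of _ \<beta>] allI impI refl d(5,6) bij_zero_set[OF \<beta>] card
            reg'(2-4) jump'(2-4)) assumption+
    qed
  next
    case 2
    show ?case
    proof (intro allI impI, goal_cases)
      case (1 r \<rho> \<pi>)
      then have r: "r \<le> n1 n" "2 * (r + 1) \<le> n + 2" and cls: "\<alpha> \<in> hankel_class n r \<rho> \<pi>" and \<pi>: "\<pi> \<ge> 1"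
        using half by auto
      note d = generators_of_char_polys[OF ch cls r(1)] and s = singular_class_data[OF ch cls r(1) \<pi>]
      have c: "r \<le> n + 2 - r" "r \<le> dim_vec \<alpha>" "r + 1 < n + 2 - r" "degree A1 < r" "A1 \<noteq> 0"
        using r dim d(4,7) s(1) by auto
      obtain \<beta> where \<beta>: "bij \<beta>"
        and jump: "\<And>a. hankel_generators (extend_seq \<alpha> a) A1 (r + 1)
           (Polynomial.smult (\<beta> a) (monom 1 (n + 2 - r - r) * A1) + A2) (n + 2 - r)"
        by (rule extend_singular[OF d(1) c(1,2) d(6) c(5,4) s(3,4)]) (rule that)
      have ext: "extend_seq \<alpha> a \<in> hankel_class (n + 1) (r + 1) \<rho> (\<pi> + 1) \<and>
        char_deg1 (n + 1) (extend_seq \<alpha> a) = r + 1 \<and> char_deg2 (n + 1) (extend_seq \<alpha> a) = n + 2 - r \<and>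
        char_polys (n + 1) (extend_seq \<alpha> a) A1
          (Polynomial.smult (\<beta> a) (monom 1 (n + 2 - r - r) * A1) + A2)" for a
      proof -
        note g = singular_jump_generator[OF d(6,7) c(4,1) s(4,3), of "\<beta> a"]
        have side: "r + 1 \<le> n + 2 - r" "degree A1 \<le> r + 1"
          "degree (Polynomial.smult (\<beta> a) (monom 1 (n + 2 - r - r) * A1) + A2) \<le> n + 2 - r"
          using c g(3) by auto
        note * = char_polys_of_generators[OF jump car' n side(1) g(1) d(7) g(2) side(2,3)]
        have "r + 1 - degree A1 = \<pi> + 1" using d(4) s(2) by simp
        then show ?thesis using * c d(4) by simp
      qed
      show ?case
        unfolding d(2,3) by (intro conjI exI[of _ \<beta>] refl \<beta> s(2,3) d(4) allI) (use ext in blast)+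
    qed
  next
    case 3
    show ?case
    proof (intro impI, goal_cases)
      case 1
      then have ev: "n + 2 = 2 * n1 n" and cls: "\<alpha> \<in> hankel_class n (n1 n) (n1 n) 0" using half by auto
      define r where "r = n1 n"
      note cls = cls[folded r_def]
      have r: "r \<le> n1 n" "n + 2 - r = r" "r \<ge> 1" "n + 3 - r = r + 1" "n = 2 * r - 2" using ev half(1) by (auto simp: r_def)
      note d = nonsingular_class_data[OF ch cls r(1), unfolded r(2)]
      have deg: "char_deg1 n \<alpha> = r" "char_deg2 n \<alpha> = r"
        using generators_of_char_polys(2,3)[OF ch cls r(1)] r(2) by simp_all
      obtain \<beta> where \<beta>: "bij \<beta>"
        and gen: "\<And>a. hankel_generators (extend_seq \<alpha> a) (Polynomial.smult (\<beta> a) A2 + A1) r A2 (r + 1)"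
        by (rule extend_nonsingular_balanced[OF d(1,2,5,3,6)]) (rule that)
      have ext: "extend_seq \<alpha> a \<in> hankel_class (n + 1) r r 0 \<and>
        char_deg1 (n + 1) (extend_seq \<alpha> a) = r \<and> char_deg2 (n + 1) (extend_seq \<alpha> a) = r + 1 \<and>
        char_polys (n + 1) (extend_seq \<alpha> a) (Polynomial.smult (\<beta> a) A2 + A1) A2" for a
      proof -
        define A1' where "A1' = Polynomial.smult (\<beta> a) A2 + A1"
        have less: "degree A2 < r" using d(5,6) r(3) by (auto simp: degree_less_def)
        then have g: "lead_coeff A1' = 1" "degree A1' = r"
          using monic_add_lower_degree[OF d(3), of "Polynomial.smult (\<beta> a) A2"] d(5) by (simp_all add: A1'_def)
        have "coprime A2 (Polynomial.smult 1 A1 + [:\<beta> a:] * A2)"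
          by (rule coprime_smult_add_mult) (use d(2) in \<open>simp_all add: coprime_commute\<close>)
        then have cop: "coprime A1' A2" by (simp add: A1'_def coprime_commute add.commute)
        have side: "r \<le> r + 1" "A2 \<noteq> 0 \<Longrightarrow> lead_coeff A2 = 1" "degree A1' \<le> r" "degree A2 \<le> r + 1"
          "degree A1' = r \<Longrightarrow> degree_less A2 A1'" "r = r + 1 \<Longrightarrow> degree A1' = r"
          "r = 1 \<Longrightarrow> degree A1' = 0 \<Longrightarrow> A2 = monom 1 (n + 1 + 1)"
          using d(4) g less r(3) by (auto simp: degree_less_def)
        show ?thesis
          using char_polys_of_generators[OF gen[of a, folded A1'_def] car' n side(1) cop g(1) side(2-7)] g(2)
          by (simp add: A1'_def)
      qed
      show ?case
        unfolding r_def[symmetric] deg by (intro conjI exI[of _ \<beta>] refl \<beta> d(5,6) allI) (use ext in blast)+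
    qed
  next
    case 4
    show ?case
    proof (intro impI, goal_cases)
      case 1
      then have od: "n + 1 = 2 * n1 n" and cls: "\<alpha> \<in> hankel_class n (n1 n) (n1 n) 0" using half by auto
      define r where "r = n1 n"
      note cls = cls[folded r_def]
      have r: "r \<le> n1 n" "n + 2 - r = r + 1" "r \<ge> 1" "n + 3 - r = r + 2" "2 * r < n + 2" "r + 1 - r = 1"
        using od half(1) by (auto simp: r_def)
      note d = nonsingular_class_data[OF ch cls r(1), unfolded r(2)]
      have deg: "char_deg1 n \<alpha> = r" "char_deg2 n \<alpha> = r + 1"
        using generators_of_char_polys(2,3)[OF ch cls r(1)] r(2) by simp_all
      have c: "r < r + 1" by simp
      obtain \<beta> where \<beta>: "bij \<beta>"
        and reg: "\<And>a. \<beta> a = 0 \<Longrightarrow> hankel_generators (extend_seq \<alpha> a) A1 r A2 (r + 1 + 1)"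
        and jump: "\<And>a. \<beta> a \<noteq> 0 \<Longrightarrow> hankel_generators (extend_seq \<alpha> a) A1 (r + 1)
           (Polynomial.smult (\<beta> a) A2 + monom 1 (r + 1 - r) * A1) (r + 1)"
        by (rule extend_nonsingular[OF d(1) c d(2,5,3,6)]) (rule that)
      have "r + 1 + 1 = n + 3 - r" using r by simp
      note reg' = regular_extension[OF ch cls assms(1) r(5) reg[unfolded this], unfolded r(4)]
      have jump': "extend_seq \<alpha> a \<in> hankel_class (n + 1) (r + 1) (r + 1) 0"
        "char_deg1 (n + 1) (extend_seq \<alpha> a) = r + 1" "char_deg2 (n + 1) (extend_seq \<alpha> a) = r + 1"
        "char_polys (n + 1) (extend_seq \<alpha> a) (Polynomial.smult (\<beta> a) A2 + monom 1 1 * A1) A1"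
        if "\<beta> a \<noteq> 0" for a
      proof -
        define A1' where "A1' = Polynomial.smult (\<beta> a) A2 + monom 1 1 * A1"
        note g = nonsingular_jump_generator[OF d(2,3,5) c d(6) that, unfolded r(6), folded A1'_def]
        \<comment> \<open>Both degree bounds are now \<open>r + 1\<close>, and the new generator of degree \<open>r + 1\<close> comes first.\<close>
        have gen: "hankel_generators (extend_seq \<alpha> a) A1' (r + 1) A1 (r + 1)"
          using jump[OF that] unfolding r(6) A1'_def[symmetric] by (simp add: hankel_generators_commute)
        have side: "r + 1 \<le> r + 1" "coprime A1' A1" "A1 \<noteq> 0 \<Longrightarrow> lead_coeff A1 = 1" "degree A1' \<le> r + 1"
          "degree A1 \<le> r + 1" "degree A1' = r + 1 \<Longrightarrow> degree_less A1 A1'"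
          "r + 1 = r + 1 \<Longrightarrow> degree A1' = r + 1"
          "r + 1 = 1 \<Longrightarrow> degree A1' = 0 \<Longrightarrow> A1 = monom 1 (n + 1 + 1)"
          using g d(3,5) by (auto simp: degree_less_def coprime_commute)
        note * = char_polys_of_generators[OF gen car' n side(1,2) g(2) side(3-8)]
        show "extend_seq \<alpha> a \<in> hankel_class (n + 1) (r + 1) (r + 1) 0" using *(1) g(3) by simp
        show "char_deg1 (n + 1) (extend_seq \<alpha> a) = r + 1" by (rule *(2))
        show "char_deg2 (n + 1) (extend_seq \<alpha> a) = r + 1" by (rule *(3))
        show "char_polys (n + 1) (extend_seq \<alpha> a) (Polynomial.smult (\<beta> a) A2 + monom 1 1 * A1) A1"
          unfolding A1'_def[symmetric] by (rule *(4))
      qed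
      have iff: "extend_seq \<alpha> a \<in> hankel_class (n + 1) r r 0 \<longleftrightarrow> \<beta> a = 0"
        "extend_seq \<alpha> a \<in> hankel_class (n + 1) (r + 1) (r + 1) 0 \<longleftrightarrow> \<beta> a \<noteq> 0" for a
        using reg'(1)[of a] jump'(1)[of a] by (cases "\<beta> a = 0"; auto simp: hankel_class_def)+
      have card: "card {a. \<beta> a \<noteq> 0} = card (UNIV :: 'a set) - 1"
        using bij_betw_same_card[OF bij_zero_set(2)[OF \<beta>]] by (simp add: card_Diff_subset)
      show ?case
        unfolding r_def[symmetric] iff deg
        by (intro conjI exI[of _ \<beta>] allI impI refl d(5,6) bij_zero_set[OF \<beta>] card
            reg'(2-4) jump'(2-4)) assumption+
    qed
  next
    case 5
    show ?case
    proof (intro allI impI, goal_cases)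
      case (1 \<rho> \<pi>)
      then have od: "n + 1 = 2 * n1 n" and cls: "\<alpha> \<in> hankel_class n (n1 n) \<rho> \<pi>" and \<pi>: "\<pi> \<ge> 1"
        using half by auto
      define r where "r = n1 n"
      note cls = cls[folded r_def]
      have r: "r \<le> n1 n" "n + 2 - r = r + 1" "r + 1 - r = 1" using od half(1) by (auto simp: r_def)
      note d = generators_of_char_polys[OF ch cls r(1), unfolded r(2)]
        and s = singular_class_data[OF ch cls r(1) \<pi>, unfolded r(2)]
      have c: "r \<le> r + 1" "r \<le> dim_vec \<alpha>" "degree A1 < r" "A1 \<noteq> 0"
        using r od dim d(4,7) s(1) by (auto simp: r_def)
      obtain \<beta> where \<beta>: "bij \<beta>"
        and jump: "\<And>a. hankel_generators (extend_seq \<alpha> a) A1 (r + 1)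
           (Polynomial.smult (\<beta> a) (monom 1 (r + 1 - r) * A1) + A2) (r + 1)"
        by (rule extend_singular[OF d(1) c(1,2) d(6) c(4,3) s(3,4)]) (rule that)
      have ext: "extend_seq \<alpha> a \<in> hankel_class (n + 1) (r + 1) (r + 1) 0 \<and>
        char_deg1 (n + 1) (extend_seq \<alpha> a) = r + 1 \<and> char_deg2 (n + 1) (extend_seq \<alpha> a) = r + 1 \<and>
        char_polys (n + 1) (extend_seq \<alpha> a) (Polynomial.smult (\<beta> a) (monom 1 1 * A1) + A2) A1" for a
      proof -
        define A1' where "A1' = Polynomial.smult (\<beta> a) (monom 1 1 * A1) + A2"
        note g = singular_jump_generator[OF d(6,7) c(3,1) s(4,3), of "\<beta> a", unfolded r(3), folded A1'_def]
        \<comment> \<open>Both degree bounds are now \<open>r + 1\<close>, and the new generator of degree \<open>r + 1\<close> comes first.\<close>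
        have gen: "hankel_generators (extend_seq \<alpha> a) A1' (r + 1) A1 (r + 1)"
          using jump[of a] unfolding r(3) A1'_def[symmetric] by (simp add: hankel_generators_commute)
        have side: "r + 1 \<le> r + 1" "coprime A1' A1" "A1 \<noteq> 0 \<Longrightarrow> lead_coeff A1 = 1" "degree A1' \<le> r + 1"
          "degree A1 \<le> r + 1" "degree A1' = r + 1 \<Longrightarrow> degree_less A1 A1'"
          "r + 1 = r + 1 \<Longrightarrow> degree A1' = r + 1"
          "r + 1 = 1 \<Longrightarrow> degree A1' = 0 \<Longrightarrow> A1 = monom 1 (n + 1 + 1)"
          using g d(7) c(3) by (auto simp: degree_less_def coprime_commute)
        show ?thesis
          using char_polys_of_generators[OF gen car' n side(1,2) g(2) side(3-8)] g(3)
          by (simp add: A1'_def)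
      qed
      show ?case
        unfolding r_def[symmetric] d(2,3) by (intro conjI exI[of _ \<beta>] refl \<beta> s(3) d(4) allI) (use ext in blast)+
    qed
  qed
qed

end
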